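(* Let $\mathcal{H}\in C^1(\mathbb{S}^2)$. If $\mathcal{H}$ vanishes at some point of $\mathbb{S}^2$, then there are no closed $\mathcal{H}$-surfaces in $\mathbb{R}^3$.
   Context: $\mathbb{S}^2$ is the unit sphere of $\mathbb{R}^3$. Surfaces are smooth, connected and oriented, immersed in $\mathbb{R}^3$, with Gauss map (unit normal field) $N:M\to\mathbb{S}^2$. The mean curvature $H_M$ is the average of the principal curvatures with respect to $N$, with the sign convention that the graph of $u$ oriented by $N=(-Du,1)/\sqrt{1+|Du|^2}$ has $2H_M=\mathrm{div}\big(Du/\sqrt{1+|Du|^2}\big)$ (so a unit sphere with inward normal has $H_M=1$). Given $\mathcal{H}\in C^1(\mathbb{S}^2)$, an $\mathcal{H}$-surface is a surface $M$ such that $H_M(p)=\mathcal{H}(N_p)$ for all $p\in M$. A surface is closed if it is compact without boundary. *)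

theory Defs
  imports "HOL-Analysis.Analysis"
begin

section \<open>Functions of class \<open>C\<^sup>k\<close>\<close>

text \<open>Intended for open \<open>S\<close>: all iterated directional derivatives up to order \<open>k\<close> exist in the
  Frechet sense and are continuous.\<close>

primrec C_k_on :: "nat \<Rightarrow> ('a::real_normed_vector \<Rightarrow> 'b::real_normed_vector) \<Rightarrow> 'a set \<Rightarrow> bool" where
  "C_k_on 0 f S \<longleftrightarrow> continuous_on S f"
| "C_k_on (Suc k) f S \<longleftrightarrow>
     (\<forall>x\<in>S. f differentiable (at x)) \<and> (\<forall>v. C_k_on k (\<lambda>x. frechet_derivative f (at x) v) S)"

definition smooth_on :: "('a::real_normed_vector \<Rightarrow> 'b::real_normed_vector) \<Rightarrow> 'a set \<Rightarrow> bool" where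
  "smooth_on f S \<longleftrightarrow> (\<forall>k. C_k_on k f S)"

text \<open>A function is of class \<open>C\<^sup>1\<close> on the submanifold \<open>sphere 0 1\<close> of three-space iff it has, near each
  point of the sphere, a \<open>C\<^sup>1\<close> extension to an open set of the ambient space. Values off the sphere
  are irrelevant.\<close>

definition C1_on_sphere :: "(real^3 \<Rightarrow> real) \<Rightarrow> bool" where
  "C1_on_sphere h \<longleftrightarrow> (\<forall>x\<in>sphere 0 1. \<exists>W g. open W \<and> x \<in> W \<and> C_k_on 1 g W
      \<and> (\<forall>y\<in>W \<inter> sphere 0 1. g y = h y))"

section \<open>Smooth surfaces\<close>

text \<open>The atlas consists of pairs \<open>(V, \<psi>)\<close>, where the local parametrization \<open>\<psi>\<close> is the inverse of a
  chart and maps the open set \<open>V\<close> of the plane homeomorphically onto an open subset of \<open>X\<close>.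
  As the sets \<open>V\<close> are open in the plane, the surface has no boundary.\<close>

type_synonym 'a atlas = "((real^2) set \<times> (real^2 \<Rightarrow> 'a)) set"

locale smooth_surface =
  fixes X :: "'a topology" and A :: "'a atlas"
  assumes Hausdorff: "Hausdorff_space X"
    and second_countable: "second_countable X"
    and nonempty: "topspace X \<noteq> {}"
    and connected: "connected_space X"
    and parametrization: "(V, \<psi>) \<in> A \<Longrightarrow>
          open V \<and> embedding_map (top_of_set V) X \<psi> \<and> openin X (\<psi> ` V)"
    and covering: "topspace X = (\<Union>(V, \<psi>)\<in>A. \<psi> ` V)"
    and transition: "\<lbrakk>(V, \<psi>) \<in> A; (V', \<psi>') \<in> A\<rbrakk> \<Longrightarrow>
          smooth_on (inv_into V' \<psi>' \<circ> \<psi>) (V \<inter> \<psi> -` (\<psi>' ` V'))"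

text \<open>The orientation of the surface is given by the choice of the unit normal field \<open>N\<close> along the
  immersion \<open>f\<close>; in three-space the two data are equivalent.\<close>

locale oriented_immersed_surface = smooth_surface X A
  for X :: "'a topology" and A :: "'a atlas" +
  fixes f N :: "'a \<Rightarrow> real^3"
  assumes smooth_f: "(V, \<psi>) \<in> A \<Longrightarrow> smooth_on (f \<circ> \<psi>) V"
    and immersion: "\<lbrakk>(V, \<psi>) \<in> A; u \<in> V\<rbrakk> \<Longrightarrow> inj (frechet_derivative (f \<circ> \<psi>) (at u))"
    and smooth_N: "(V, \<psi>) \<in> A \<Longrightarrow> smooth_on (N \<circ> \<psi>) V"
    and unit_N: "p \<in> topspace X \<Longrightarrow> N p \<in> sphere 0 1"
    and normal_N: "\<lbrakk>(V, \<psi>) \<in> A; u \<in> V\<rbrakk> \<Longrightarrow>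
          N (\<psi> u) \<bullet> frechet_derivative (f \<circ> \<psi>) (at u) w = 0"

section \<open>Curvature\<close>

text \<open>\<open>k\<^sub>1\<close> and \<open>k\<^sub>2\<close> are the eigenvalues, with multiplicity, of the shape operator \<open>-dN\<close> at \<open>p\<close>, where
  tangent vectors are identified with their images under \<open>df\<close>: there is an orthonormal basis
  \<open>df w\<^sub>1, df w\<^sub>2\<close> of the tangent plane with \<open>-dN w\<^sub>i = k\<^sub>i df w\<^sub>i\<close>. With this sign, the unit sphere with
  inward normal \<open>N = - f\<close> has \<open>k\<^sub>1 = k\<^sub>2 = 1\<close>. The choice of the parametrization is immaterial.\<close>

definition principal_curvatures ::
  "'a atlas \<Rightarrow> ('a \<Rightarrow> real^3) \<Rightarrow> ('a \<Rightarrow> real^3) \<Rightarrow> 'a \<Rightarrow> real \<Rightarrow> real \<Rightarrow> bool" where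
  "principal_curvatures A f N p k\<^sub>1 k\<^sub>2 \<longleftrightarrow>
     (\<exists>(V, \<psi>)\<in>A. \<exists>u\<in>V. \<psi> u = p \<and>
        (let df = frechet_derivative (f \<circ> \<psi>) (at u); dN = frechet_derivative (N \<circ> \<psi>) (at u)
         in \<exists>w\<^sub>1 w\<^sub>2. norm (df w\<^sub>1) = 1 \<and> norm (df w\<^sub>2) = 1 \<and> df w\<^sub>1 \<bullet> df w\<^sub>2 = 0 \<and>
              - dN w\<^sub>1 = k\<^sub>1 *\<^sub>R df w\<^sub>1 \<and> - dN w\<^sub>2 = k\<^sub>2 *\<^sub>R df w\<^sub>2))"

definition mean_curvature ::
  "'a atlas \<Rightarrow> ('a \<Rightarrow> real^3) \<Rightarrow> ('a \<Rightarrow> real^3) \<Rightarrow> 'a \<Rightarrow> real" where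
  "mean_curvature A f N p =
     (THE h. \<exists>k\<^sub>1 k\<^sub>2. principal_curvatures A f N p k\<^sub>1 k\<^sub>2 \<and> h = (k\<^sub>1 + k\<^sub>2) / 2)"

locale prescribed_mean_curvature_surface = oriented_immersed_surface X A f N
  for X :: "'a topology" and A :: "'a atlas" and f N :: "'a \<Rightarrow> real^3" +
  fixes \<H> :: "real^3 \<Rightarrow> real"
  assumes mean_curvature_eq: "p \<in> topspace X \<Longrightarrow> mean_curvature A f N p = \<H> (N p)"

text \<open>Absence of boundary is part of \<open>smooth_surface\<close>.\<close>

definition closed_surface :: "'a topology \<Rightarrow> 'a atlas \<Rightarrow> bool" where
  "closed_surface X A \<longleftrightarrow> smooth_surface X A \<and> compact_space X"

end

theory Submission
  imports Defs
begin

text \<open>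
  Let \<open>\<H>\<close> vanish at the unit vector \<open>n\<close>. A closed surface has a highest point in every direction \<open>d\<close>.
  There its normal is \<open>d\<close> or \<open>- d\<close>, and since the surface lies on one side of its tangent plane, its
  mean curvature is at most \<open>0\<close> in the first case and at least \<open>0\<close> in the second
  (\<open>highest_point_normal\<close>).

  The core of the proof is that \<open>\<H>\<close> cannot vanish at the normal of a highest point
  (\<open>highest_point_not_zero\<close>). If it did, the tangent plane would itself be an \<open>\<H>\<close>-surface that touches
  the given one from one side, and the strong maximum principle would force the two to coincide. The
  theorem follows by looking at the highest points in the directions \<open>n\<close> and \<open>- n\<close>. The normal at
  either of them is \<open>n\<close> or \<open>- n\<close>; it is not \<open>n\<close>, so it is \<open>- n\<close> at both; the signs of the mean
  curvature there give \<open>\<H> (- n) \<ge> 0\<close> and \<open>\<H> (- n) \<le> 0\<close>, so \<open>\<H> (- n) = 0\<close>, which is excluded as well.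

  The surface need not be written as a graph for the touching argument, because in any local
  parametrization \<open>F\<close> with normal \<open>G\<close> the height \<open>h = d \<bullet> F\<close> satisfies a linear elliptic
  inequality. Let \<open>w1\<close>, \<open>w2\<close> be mapped by \<open>DF\<close> to an orthonormal basis of principal directions. The
  sum of the second derivatives of \<open>F\<close> along \<open>w1\<close> and \<open>w2\<close> has normal component \<open>2 \<H> (G)\<close>, and its
  tangential component enters \<open>D\<^sup>2h\<close> multiplied by the tangential part of \<open>d\<close>, that is, by \<open>Dh\<close>. Let
  \<open>n0\<close> be the normal at the touching point. As \<open>\<H>\<close> is differentiable and \<open>\<H> n0 = 0\<close>, the value
  \<open>\<H> (G)\<close> is bounded by a multiple of the length of \<open>G - n0\<close>, and this length is bounded by the
  tangential part of \<open>d\<close> too. Altogether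
  \<open>\<bar>D\<^sup>2h(w1,w1) + D\<^sup>2h(w2,w2)\<bar> \<le> C (\<bar>Dh(w1)\<bar> + \<bar>Dh(w2)\<bar>)\<close>, without a term in \<open>h\<close> itself, and Hopf's
  argument shows that \<open>h\<close> is constant near its maximum (\<open>strong_maximum_principle\<close>,
  \<open>maximal_height_rigidity\<close>). By connectedness the surface lies in a plane and has constant normal;
  this is absurd, as a highest point in a direction \<open>e\<close> of that plane has normal \<open>e\<close> or \<open>- e\<close>.
\<close>

section \<open>Second derivatives\<close>

lemma has_real_derivative_along_line:
  fixes f :: "'a::real_normed_vector \<Rightarrow> real"
  assumes "(f has_derivative D) (at (x + s *\<^sub>R v))"
  shows "((\<lambda>s. f (x + s *\<^sub>R v)) has_real_derivative D v) (at s)"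
proof -
  interpret bounded_linear D using assms by (rule has_derivative_bounded_linear)
  have "((\<lambda>s. f (x + s *\<^sub>R v)) has_derivative (\<lambda>t. D (t *\<^sub>R v))) (at s)"
    by (rule has_derivative_compose[of "\<lambda>s. x + s *\<^sub>R v" "\<lambda>t. t *\<^sub>R v" s UNIV f D])
      (auto intro!: derivative_eq_intros assms)
  then show ?thesis
    by (simp add: has_field_derivative_def scale mult.commute[of _ "D v"])
qed

text \<open>The mean value theorem in direction \<open>v\<close> turns the second difference into a difference of values
  of \<open>Df _ v\<close>, which the derivative at \<open>x\<close> resolves to first order. The left-hand side is symmetric
  in \<open>v\<close> and \<open>w\<close>; this yields the symmetry of second derivatives below.\<close>

lemma second_difference_quotient_tendsto:
  fixes f :: "'a::real_normed_vector \<Rightarrow> real"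
  assumes "open S" "x \<in> S"
    and Df: "\<And>y. y \<in> S \<Longrightarrow> (f has_derivative Df y) (at y)"
    and D2f: "((\<lambda>y. Df y v) has_derivative D2) (at x)"
  shows "((\<lambda>t. (f (x + t *\<^sub>R v + t *\<^sub>R w) - f (x + t *\<^sub>R v) - f (x + t *\<^sub>R w) + f x) / t^2)
            \<longlongrightarrow> D2 w) (at_right 0)"
proof (rule tendstoI)
  fix e :: real assume "0 < e"
  interpret D2: bounded_linear D2 using D2f by (rule has_derivative_bounded_linear)
  define K where "K = 2 * norm v + norm w + 1"
  have "0 < K" by (simp add: K_def add_nonneg_pos)
  define e' where "e' = e / K"
  have "0 < e'" using \<open>0 < e\<close> \<open>0 < K\<close> by (simp add: e'_def)
  obtain d1 where d1: "0 < d1"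
    and lin: "\<And>y. norm (y - x) < d1 \<Longrightarrow> norm (Df y v - Df x v - D2 (y - x)) \<le> e' * norm (y - x)"
    using D2f \<open>0 < e'\<close> unfolding has_derivative_at_alt by blast
  obtain d2 where d2: "0 < d2" "ball x d2 \<subseteq> S"
    using assms(1,2) open_contains_ball by blast
  define T where "T = min d1 d2 / K"
  have "0 < T" using d1 d2 \<open>0 < K\<close> by (simp add: T_def)
  have "dist ((f (x + t *\<^sub>R v + t *\<^sub>R w) - f (x + t *\<^sub>R v) - f (x + t *\<^sub>R w) + f x) / t^2) (D2 w) < e"
    if t: "0 < t" "t < T" for t
  proof -
    have tK: "t * K < d1" "t * K < d2" using t \<open>0 < K\<close> by (auto simp: T_def field_simps)
    have small1: "norm (s *\<^sub>R v + t *\<^sub>R w) \<le> t * (norm v + norm w)" if "0 \<le> s" "s \<le> t" for s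
    proof -
      have "norm (s *\<^sub>R v + t *\<^sub>R w) \<le> s * norm v + t * norm w"
        using norm_triangle_ineq[of "s *\<^sub>R v" "t *\<^sub>R w"] that t by simp
      also have "\<dots> \<le> t * norm v + t * norm w" using that by (simp add: mult_right_mono)
      finally show ?thesis by (simp add: algebra_simps)
    qed
    have small2: "norm (s *\<^sub>R v) \<le> t * norm v" if "0 \<le> s" "s \<le> t" for s
      using that by (simp add: mult_right_mono)
    have "t * (norm v + norm w) < t * K" "t * norm v < t * K"
      using t by (auto simp: K_def intro!: mult_strict_left_mono add_nonneg_pos)
    then have inS: "x + s *\<^sub>R v + t *\<^sub>R w \<in> S" "x + s *\<^sub>R v \<in> S"
      and near: "norm (s *\<^sub>R v + t *\<^sub>R w) < d1" "norm (s *\<^sub>R v) < d1" if "0 \<le> s" "s \<le> t" for s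
    proof -
      note small1[OF that] small2[OF that]
      moreover have "x + u \<in> S" if "norm u < d2" for u
        using d2(2) that by (auto simp: dist_norm subset_eq)
      ultimately show "x + s *\<^sub>R v + t *\<^sub>R w \<in> S" "x + s *\<^sub>R v \<in> S"
        "norm (s *\<^sub>R v + t *\<^sub>R w) < d1" "norm (s *\<^sub>R v) < d1"
        using tK \<open>t * (norm v + norm w) < t * K\<close> \<open>t * norm v < t * K\<close>
        by (simp_all only: add.assoc)
    qed
    have "((\<lambda>s. f ((x + t *\<^sub>R w) + s *\<^sub>R v) - f (x + s *\<^sub>R v)) has_real_derivative
             (Df ((x + t *\<^sub>R w) + s *\<^sub>R v) v - Df (x + s *\<^sub>R v) v)) (at s)"
      if "0 \<le> s" "s \<le> t" for s
      by (intro DERIV_diff has_real_derivative_along_line Df)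
        (use inS[OF that] in \<open>simp_all add: algebra_simps\<close>)
    from MVT2[OF \<open>0 < t\<close> this] obtain s where s: "0 < s" "s < t"
      and mv: "(f (x + t *\<^sub>R w + t *\<^sub>R v) - f (x + t *\<^sub>R v)) - (f (x + t *\<^sub>R w) - f x) =
        t * (Df (x + t *\<^sub>R w + s *\<^sub>R v) v - Df (x + s *\<^sub>R v) v)"
      by auto
    define E1 where "E1 = Df (x + t *\<^sub>R w + s *\<^sub>R v) v - Df x v - D2 (s *\<^sub>R v + t *\<^sub>R w)"
    define E2 where "E2 = Df (x + s *\<^sub>R v) v - Df x v - D2 (s *\<^sub>R v)"
    have "\<bar>E1\<bar> \<le> e' * norm (s *\<^sub>R v + t *\<^sub>R w)"
      using lin[of "x + t *\<^sub>R w + s *\<^sub>R v"] near(1)[of s] s by (simp add: E1_def algebra_simps)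
    also have "\<dots> \<le> e' * (t * (norm v + norm w))"
      using small1[of s] s \<open>0 < e'\<close> by (intro mult_left_mono) auto
    finally have E1: "\<bar>E1\<bar> \<le> e' * (t * (norm v + norm w))" .
    have "\<bar>E2\<bar> \<le> e' * norm (s *\<^sub>R v)"
      using lin[of "x + s *\<^sub>R v"] near(2)[of s] s by (simp add: E2_def)
    also have "\<dots> \<le> e' * (t * norm v)"
      using small2[of s] s \<open>0 < e'\<close> by (intro mult_left_mono) auto
    finally have E2: "\<bar>E2\<bar> \<le> e' * (t * norm v)" .
    have "Df (x + t *\<^sub>R w + s *\<^sub>R v) v - Df (x + s *\<^sub>R v) v = t * D2 w + (E1 - E2)"
      by (simp add: E1_def E2_def D2.add D2.scale)
    then have "f (x + t *\<^sub>R v + t *\<^sub>R w) - f (x + t *\<^sub>R v) - f (x + t *\<^sub>R w) + f x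
        = t * (t * D2 w + (E1 - E2))"
      using mv by (simp only:) (simp add: algebra_simps)
    then have "(f (x + t *\<^sub>R v + t *\<^sub>R w) - f (x + t *\<^sub>R v) - f (x + t *\<^sub>R w) + f x) / t^2 - D2 w
        = (E1 - E2) / t"
      using t by (simp only:) (simp add: field_simps power2_eq_square)
    moreover have "\<bar>(E1 - E2) / t\<bar> < e"
    proof -
      have "\<bar>E1 - E2\<bar> \<le> e' * t * (2 * norm v + norm w)"
        using E1 E2 by (simp add: algebra_simps)
      also have "\<dots> < e' * t * K"
        using \<open>0 < e'\<close> t by (intro mult_strict_left_mono) (auto simp: K_def)
      also have "\<dots> = e * t" using \<open>0 < K\<close> by (simp add: e'_def)
      finally show ?thesis using t by (simp add: field_simps)
    qed
    ultimately show ?thesis by (simp add: dist_real_def)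
  qed
  then show "\<forall>\<^sub>F t in at_right 0.
      dist ((f (x + t *\<^sub>R v + t *\<^sub>R w) - f (x + t *\<^sub>R v) - f (x + t *\<^sub>R w) + f x) / t^2) (D2 w) < e"
    using \<open>0 < T\<close> unfolding eventually_at_right_field by blast
qed

lemma second_derivative_symmetric:
  fixes f :: "'a::real_normed_vector \<Rightarrow> real"
  assumes "open S" "x \<in> S"
    and Df: "\<And>y. y \<in> S \<Longrightarrow> (f has_derivative Df y) (at y)"
    and D2f: "\<And>v. ((\<lambda>y. Df y v) has_derivative D2 v) (at x)"
  shows "D2 v w = D2 w v"
proof (rule tendsto_unique)
  show "((\<lambda>t. (f (x + t *\<^sub>R v + t *\<^sub>R w) - f (x + t *\<^sub>R v) - f (x + t *\<^sub>R w) + f x) / t^2)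
            \<longlongrightarrow> D2 v w) (at_right 0)"
    by (rule second_difference_quotient_tendsto[OF assms(1,2) Df D2f])
  have "((\<lambda>t. (f (x + t *\<^sub>R w + t *\<^sub>R v) - f (x + t *\<^sub>R w) - f (x + t *\<^sub>R v) + f x) / t^2)
            \<longlongrightarrow> D2 w v) (at_right 0)"
    by (rule second_difference_quotient_tendsto[OF assms(1,2) Df D2f])
  then show "((\<lambda>t. (f (x + t *\<^sub>R v + t *\<^sub>R w) - f (x + t *\<^sub>R v) - f (x + t *\<^sub>R w) + f x) / t^2)
            \<longlongrightarrow> D2 w v) (at_right 0)"
    by (rule back_subst) (simp add: add_ac diff_right_commute algebra_simps)
qed simp

text \<open>If the second derivative along \<open>v\<close> were positive, the first one, which vanishes at \<open>x\<close>, would be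
  positive just after \<open>x\<close>, and \<open>f\<close> would increase there.\<close>

lemma interior_maximum_derivatives:
  fixes f :: "'a::real_normed_vector \<Rightarrow> real"
  assumes "open S" "x \<in> S"
    and Df: "\<And>y. y \<in> S \<Longrightarrow> (f has_derivative Df y) (at y)"
    and D2f: "((\<lambda>y. Df y v) has_derivative D2) (at x)"
    and max: "\<And>y. y \<in> S \<Longrightarrow> f y \<le> f x"
  shows "Df x v = 0" and "D2 v \<le> 0"
proof -
  show Df0: "Df x v = 0"
    using differential_zero_maxmin[OF \<open>x \<in> S\<close> \<open>open S\<close> Df[OF \<open>x \<in> S\<close>]] max by metis
  show "D2 v \<le> 0"
  proof (rule ccontr)
    assume "\<not> D2 v \<le> 0"
    have "((\<lambda>s. Df (x + s *\<^sub>R v) v) has_real_derivative D2 v) (at 0)"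
      by (rule has_real_derivative_along_line) (simp add: D2f)
    from DERIV_pos_inc_right[OF this] \<open>\<not> D2 v \<le> 0\<close> obtain d1
      where d1: "0 < d1" and inc: "\<And>s. 0 < s \<Longrightarrow> s < d1 \<Longrightarrow> 0 < Df (x + s *\<^sub>R v) v"
      using Df0 by auto
    obtain d2 where d2: "0 < d2" "ball x d2 \<subseteq> S"
      using assms(1,2) open_contains_ball by blast
    define t where "t = min (d1 / 2) (d2 / (norm v + 1))"
    have n1: "0 < norm v + 1" by (simp add: add_nonneg_pos)
    have t: "0 < t" "t < d1" "t * (norm v + 1) \<le> d2"
      using d1 d2 n1 by (simp_all add: t_def flip: pos_le_divide_eq)
    have inS: "x + s *\<^sub>R v \<in> S" if "0 \<le> s" "s \<le> t" for s
    proof -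
      have "s * norm v \<le> t * norm v" using that by (simp add: mult_right_mono)
      also have "\<dots> < d2" using t by (simp add: algebra_simps)
      finally show ?thesis using d2(2) that by (auto simp: dist_norm subset_eq)
    qed
    have "((\<lambda>s. f (x + s *\<^sub>R v)) has_real_derivative Df (x + s *\<^sub>R v) v) (at s)"
      if "0 \<le> s" "s \<le> t" for s
      by (rule has_real_derivative_along_line[OF Df[OF inS[OF that]]])
    from MVT2[OF \<open>0 < t\<close> this] obtain s where s: "0 < s" "s < t"
      and "f (x + t *\<^sub>R v) - f x = t * Df (x + s *\<^sub>R v) v" by auto
    then have "f x < f (x + t *\<^sub>R v)" using inc[of s] t by (smt (verit) mult_pos_pos)
    with max[OF inS[of t]] t show False by simp
  qed
qed

section \<open>The strong maximum principle\<close>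

text \<open>The ball with diameter from \<open>x\<close> to \<open>z\<close> touches the sphere around \<open>x\<close> through \<open>z\<close> from inside at
  the point \<open>z\<close> only, by the parallelogram law. So a contact point on the boundary of a ball can be
  isolated by halving the ball.\<close>

lemma cball_half_touches_once:
  fixes x z p :: "'a::real_inner"
  assumes "dist p (midpoint x z) \<le> dist x z / 2" and "dist x z \<le> dist p x"
  shows "p = z"
proof -
  define a b where "a = p - midpoint x z" and "b = x - midpoint x z"
  have z: "z - midpoint x z = - b" 
    using midpoint_plus_self[of x z] by (simp add: b_def algebra_simps)
  have "norm b = dist x z / 2" using dist_midpoint(1)[of x z] by (simp add: b_def dist_norm)
  moreover have "norm a \<le> dist x z / 2" using assms(1) by (simp add: a_def dist_norm)
  moreover have "dist x z \<le> norm (a - b)" using assms(2) by (simp add: a_def b_def dist_norm)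
  moreover have "(norm (a + b))\<^sup>2 = 2 * (norm a)\<^sup>2 + 2 * (norm b)\<^sup>2 - (norm (a - b))\<^sup>2"
    by (simp add: power2_norm_eq_inner inner_simps inner_commute)
  moreover from calculation have "(norm a)\<^sup>2 \<le> (dist x z)\<^sup>2 / 4" "(norm b)\<^sup>2 = (dist x z)\<^sup>2 / 4"
    "(dist x z)\<^sup>2 \<le> (norm (a - b))\<^sup>2"
    using power_mono[of "norm a" "dist x z / 2" 2]
    by (simp_all add: power_divide del: eq_divide_eq_numeral1 eq_divide_eq)
  ultimately have "(norm (a + b))\<^sup>2 \<le> 0" by linarith
  then have "a = - b" by (simp add: add_eq_0_iff2)
  then show ?thesis using z unfolding a_def by (metis diff_add_cancel)
qed

text \<open>
  Hopf's argument. The vectors \<open>w i\<close> encode the elliptic operator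
  \<open>(\<Sum>i\<in>I. D2h x (w i) (w i))\<close> at \<open>x\<close>; \<open>c\<close> is its ellipticity constant and \<open>K\<close> bounds its
  coefficients. The vectors are existentially quantified at each point, because principal frames exist
  pointwise and need not vary continuously.

  If \<open>h\<close> is not constant, some ball on which \<open>h < h x0\<close> has on its boundary a point \<open>z\<close> with
  \<open>h z = h x0\<close>. Add to \<open>h\<close> a small multiple of a barrier \<open>\<phi>\<close> that is positive inside the ball,
  zero on its boundary and negative outside. On a small sphere around \<open>z\<close> the sum stays below \<open>h x0\<close>,
  which is its value at \<open>z\<close>, so it has an interior maximum near \<open>z\<close>. For a steep barrier this
  contradicts the differential inequality.
\<close>

lemma strong_maximum_principle:
  fixes h :: "'a::euclidean_space \<Rightarrow> real"
  assumes Dh: "\<And>x. x \<in> ball x0 R \<Longrightarrow> (h has_derivative Dh x) (at x)"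
    and D2h: "\<And>x v. x \<in> ball x0 R \<Longrightarrow> ((\<lambda>y. Dh y v) has_derivative D2h x v) (at x)"
    and "0 < c" "0 \<le> C"
    and subsol: "\<And>x. x \<in> ball x0 R \<Longrightarrow> \<exists>w. (\<forall>i\<in>I. norm (w i) \<le> K)
        \<and> (\<forall>\<xi>. c * (\<xi> \<bullet> \<xi>) \<le> (\<Sum>i\<in>I. (\<xi> \<bullet> w i)\<^sup>2))
        \<and> 0 \<le> (\<Sum>i\<in>I. D2h x (w i) (w i)) + C * (\<Sum>i\<in>I. \<bar>Dh x (w i)\<bar>)"
    and max: "\<And>x. x \<in> ball x0 R \<Longrightarrow> h x \<le> h x0"
    and x1: "x1 \<in> ball x0 (R/2)"
  shows "h x1 = h x0"
proof (rule ccontr)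
  assume "h x1 \<noteq> h x0"
  \<comment> \<open>The ball around \<open>x1\<close> of radius \<open>dist x0 x1\<close> stays inside the closed ball of radius \<open>\<rho>\<close>.\<close>
  define \<rho> where "\<rho> = 2 * dist x0 x1"
  have "\<rho> < R" using x1 by (simp add: \<rho>_def)
  then have sub: "cball x0 \<rho> \<subseteq> ball x0 R" by auto
  have cont: "continuous_on (ball x0 R) h"
    by (intro differentiable_imp_continuous_on differentiable_at_imp_differentiable_on)
       (use Dh in \<open>auto simp: differentiable_def\<close>)
  define Z where "Z = {z \<in> cball x0 \<rho>. h z = h x0}"
  have "closed Z"
    unfolding Z_def using continuous_closed_preimage_constant[OF continuous_on_subset[OF cont sub] closed_cball]
    by simp
  moreover have "x0 \<in> Z" by (simp add: Z_def \<rho>_def)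
  ultimately obtain z where z: "z \<in> Z" "\<And>y. y \<in> Z \<Longrightarrow> dist x1 z \<le> dist x1 y"
    using distance_attains_inf[of Z x1] by auto
  define r where "r = dist x1 z / 2"
  define y where "y = midpoint x1 z"
  have "z \<noteq> x1" using z(1) \<open>h x1 \<noteq> h x0\<close> by (auto simp: Z_def)
  then have "0 < r" by (simp add: r_def)
  have zy: "dist z y = r" by (simp add: y_def r_def dist_midpoint)
  have zin: "z \<in> ball x0 R" using z(1) sub by (auto simp: Z_def)
  have below: "h p < h x0" if p: "p \<in> cball y r" "p \<noteq> z" for p
  proof -
    have "dist p x1 < dist x1 z"
      using cball_half_touches_once[of p x1 z] p by (force simp: y_def r_def dist_commute)
    moreover have "dist x1 z \<le> dist x0 x1" using z(2)[OF \<open>x0 \<in> Z\<close>] by (simp add: dist_commute)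
    ultimately have "p \<in> cball x0 \<rho>" and "p \<notin> Z"
      using z(2)[of p] dist_triangle[of x0 p x1] by (auto simp: \<rho>_def dist_commute)
    then have "p \<in> ball x0 R" "h p \<noteq> h x0" using sub by (auto simp: Z_def)
    then show ?thesis using max by force
  qed
  define t where "t = min (r / 2) ((R - dist x0 z) / 2)"
  have t: "0 < t" "t \<le> r / 2" "t < R - dist x0 z" using \<open>0 < r\<close> zin by (auto simp: t_def min_less_iff_disj)
  have subt: "cball z t \<subseteq> ball x0 R"
  proof
    fix p assume "p \<in> cball z t"
    then show "p \<in> ball x0 R" using t dist_triangle[of x0 p z] by simp
  qed
  define m where "m = real (card I)"
  define L where "L = m * K\<^sup>2 + C * m * \<bar>K\<bar> * (3 * r / 2)"
  have "0 \<le> m" by (simp add: m_def)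
  then have "0 \<le> L" using \<open>0 \<le> C\<close> \<open>0 < r\<close> by (simp add: L_def)
  \<comment> \<open>Near \<open>z\<close> the distance to \<open>y\<close> lies between \<open>r / 2\<close> and \<open>3 * r / 2\<close>. Up to the factor \<open>2 * \<alpha> * E\<close>, the
    operator applied to \<open>\<phi>\<close> is there at least \<open>2 * \<alpha> * c * (r / 2)\<^sup>2\<close> minus the sum of the \<open>w i \<bullet> w i\<close>, and
    \<open>L\<close> bounds this sum together with the gradient term. The choice of \<open>\<alpha>\<close> makes the first
    quantity equal to \<open>L + 1\<close>.\<close>
  define \<alpha> where "\<alpha> = 2 * (L + 1) / (c * r\<^sup>2)"
  have "0 < \<alpha>" using \<open>0 \<le> L\<close> \<open>0 < c\<close> \<open>0 < r\<close> by (simp add: \<alpha>_def)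
  define E where "E p = exp (- \<alpha> * ((p - y) \<bullet> (p - y)))" for p
  define \<phi> where "\<phi> p = E p - exp (- \<alpha> * r\<^sup>2)" for p
  have E_pos: "0 < E p" and E_le: "E p \<le> 1" for p using \<open>0 < \<alpha>\<close> by (auto simp: E_def)
  have \<phi>1: "\<phi> p \<le> 1" for p using E_le[of p] by (simp add: \<phi>_def) (smt (verit) exp_ge_zero)
  have \<phi>neg: "\<phi> p < 0" if "p \<notin> cball y r" for p
  proof -
    have "r\<^sup>2 < (p - y) \<bullet> (p - y)"
      using that \<open>0 < r\<close>
      by (auto simp: dist_norm norm_minus_commute simp flip: power2_norm_eq_inner intro!: power_strict_mono)
    then show ?thesis using \<open>0 < \<alpha>\<close> by (simp add: \<phi>_def E_def)
  qed
  have \<phi>z: "\<phi> z = 0" using zy by (simp add: \<phi>_def E_def dist_norm flip: power2_norm_eq_inner)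
  \<comment> \<open>Compactness leaves a gap \<open>\<delta>\<close> where the barrier is nonnegative; a multiple of the barrier by
    \<open>\<delta> / 2\<close> cannot close it.\<close>
  have "\<exists>\<delta>>0. \<forall>p \<in> sphere z t \<inter> cball y r. h p \<le> h x0 - \<delta>"
  proof (cases "sphere z t \<inter> cball y r = {}")
    case False
    have "compact (sphere z t \<inter> cball y r)" by (simp add: compact_Int_closed)
    moreover have "continuous_on (sphere z t \<inter> cball y r) h"
      using subt by (intro continuous_on_subset[OF cont]) auto
    ultimately obtain q where q: "q \<in> sphere z t \<inter> cball y r"
      and qmax: "\<And>p. p \<in> sphere z t \<inter> cball y r \<Longrightarrow> h p \<le> h q"
      using continuous_attains_sup False by metis
    have "h q < h x0" using below[of q] q t by auto
    then show ?thesis using qmax by (intro exI[of _ "h x0 - h q"]) auto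
  qed (auto intro: exI[of _ 1])
  then obtain \<delta> where \<delta>: "0 < \<delta>" "\<And>p. p \<in> sphere z t \<inter> cball y r \<Longrightarrow> h p \<le> h x0 - \<delta>"
    by blast
  define \<epsilon> where "\<epsilon> = \<delta> / 2"
  have "0 < \<epsilon>" using \<delta> by (simp add: \<epsilon>_def)
  define v where "v p = h p + \<epsilon> * \<phi> p" for p
  have v_sphere: "v p < h x0" if "p \<in> sphere z t" for p
  proof (cases "p \<in> cball y r")
    case True
    have "\<epsilon> * \<phi> p \<le> \<delta> / 2" using \<phi>1[of p] \<delta>(1) by (simp add: mult_left_le \<epsilon>_def)
    then show ?thesis using \<delta>(2)[of p] True that \<delta>(1)
      unfolding v_def by simp
  next
    case False
    then have "\<epsilon> * \<phi> p < 0" using \<phi>neg \<open>0 < \<epsilon>\<close> by (simp add: mult_pos_neg)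
    moreover have "h p \<le> h x0" using that subt by (intro max) auto
    ultimately show ?thesis by (simp add: v_def)
  qed
  have "v z = h x0" using z(1) \<phi>z by (simp add: v_def Z_def)
  have "continuous_on (cball z t) v"
    unfolding v_def \<phi>_def E_def by (intro continuous_intros continuous_on_subset[OF cont subt])
  then obtain p where p: "p \<in> cball z t" and pmax: "\<And>q. q \<in> cball z t \<Longrightarrow> v q \<le> v p"
    using continuous_attains_sup[of "cball z t" v] t by force
  have "h x0 \<le> v p" using pmax[of z] t \<open>v z = h x0\<close> by simp
  then have pball: "p \<in> ball z t" using v_sphere[of p] p by force
  define Dv where "Dv q u = Dh q u - 2 * \<alpha> * \<epsilon> * (E q * ((q - y) \<bullet> u))" for q u
  define D2v where "D2v u u' = D2h p u u'
      - 2 * \<alpha> * \<epsilon> * (E p * (u' \<bullet> u) - 2 * \<alpha> * E p * ((p - y) \<bullet> u') * ((p - y) \<bullet> u))" for u u'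
  have DE: "(E has_derivative (\<lambda>u. - 2 * \<alpha> * E q * ((q - y) \<bullet> u))) (at q)" for q
    unfolding E_def by (auto intro!: derivative_eq_intros simp: inner_commute algebra_simps)
  have Dv: "(v has_derivative Dv q) (at q)" if "q \<in> ball z t" for q
  proof -
    have "q \<in> ball x0 R" using that subt by (meson ball_subset_cball subsetD)
    then show ?thesis unfolding v_def \<phi>_def Dv_def
      by (auto intro!: derivative_eq_intros Dh DE simp: algebra_simps)
  qed
  have D2v: "((\<lambda>q. Dv q u) has_derivative D2v u) (at p)" for u
  proof -
    have "p \<in> ball x0 R" using p subt by auto
    then show ?thesis unfolding Dv_def D2v_def
      by (auto intro!: derivative_eq_intros D2h DE simp: algebra_simps)
  qed
  have vmax: "v q \<le> v p" if "q \<in> ball z t" for q using pmax[of q] that by auto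
  have Dv0: "Dv p u = 0" and D2v0: "D2v u u \<le> 0" for u
    using interior_maximum_derivatives[OF open_ball pball Dv D2v vmax] by auto
  obtain w where wK: "\<And>i. i \<in> I \<Longrightarrow> norm (w i) \<le> K"
    and well: "\<And>\<xi>. c * (\<xi> \<bullet> \<xi>) \<le> (\<Sum>i\<in>I. (\<xi> \<bullet> w i)\<^sup>2)"
    and wsub: "0 \<le> (\<Sum>i\<in>I. D2h p (w i) (w i)) + C * (\<Sum>i\<in>I. \<bar>Dh p (w i)\<bar>)"
    using subsol[OF subsetD[OF subt p]] by blast
  \<comment> \<open>The first and second order conditions at the maximum \<open>p\<close> of \<open>v\<close> express the derivatives of \<open>h\<close> by
    those of the barrier.\<close>
  have bnd: "D2h p u u + C * \<bar>Dh p u\<bar> \<le> 2 * \<alpha> * \<epsilon> * E p *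
      (u \<bullet> u - 2 * \<alpha> * ((p - y) \<bullet> u)\<^sup>2 + C * \<bar>(p - y) \<bullet> u\<bar>)" for u
  proof -
    have "Dh p u = (2 * \<alpha> * \<epsilon> * E p) * ((p - y) \<bullet> u)" using Dv0[of u] by (simp add: Dv_def)
    then have "\<bar>Dh p u\<bar> = 2 * \<alpha> * \<epsilon> * E p * \<bar>(p - y) \<bullet> u\<bar>"
      using \<open>0 < \<alpha>\<close> \<open>0 < \<epsilon>\<close> E_pos[of p] by (simp add: abs_mult)
    moreover have "D2h p u u \<le> 2 * \<alpha> * \<epsilon> * E p * (u \<bullet> u - 2 * \<alpha> * ((p - y) \<bullet> u)\<^sup>2)"
      using D2v0[of u] by (simp add: D2v_def algebra_simps power2_eq_square)
    ultimately show ?thesis by (simp add: algebra_simps)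
  qed
  have "(\<Sum>i\<in>I. D2h p (w i) (w i)) + C * (\<Sum>i\<in>I. \<bar>Dh p (w i)\<bar>)
      = (\<Sum>i\<in>I. D2h p (w i) (w i) + C * \<bar>Dh p (w i)\<bar>)"
    by (simp add: sum.distrib sum_distrib_left)
  also have "\<dots> \<le> (\<Sum>i\<in>I. 2 * \<alpha> * \<epsilon> * E p *
      (w i \<bullet> w i - 2 * \<alpha> * ((p - y) \<bullet> w i)\<^sup>2 + C * \<bar>(p - y) \<bullet> w i\<bar>))"
    by (intro sum_mono bnd)
  also have "\<dots> = 2 * \<alpha> * \<epsilon> * E p * ((\<Sum>i\<in>I. w i \<bullet> w i) - 2 * \<alpha> * (\<Sum>i\<in>I. ((p - y) \<bullet> w i)\<^sup>2)
      + C * (\<Sum>i\<in>I. \<bar>(p - y) \<bullet> w i\<bar>))"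
    by (simp add: sum.distrib sum_subtractf sum_distrib_left right_diff_distrib distrib_left)
  also have "\<dots> < 0"
  proof -
    have "dist p y \<ge> r / 2" "dist p y \<le> 3 * r / 2"
      using pball t zy dist_triangle[of z y p] dist_triangle[of p y z] by (auto simp: dist_commute)
    then have py: "r / 2 \<le> norm (p - y)" "norm (p - y) \<le> 3 * r / 2" by (auto simp: dist_norm)
    have "(\<Sum>i\<in>I. w i \<bullet> w i) \<le> (\<Sum>i\<in>I. K\<^sup>2)"
      by (intro sum_mono) (auto simp flip: power2_norm_eq_inner intro!: power_mono wK)
    then have 1: "(\<Sum>i\<in>I. w i \<bullet> w i) \<le> m * K\<^sup>2" by (simp add: m_def)
    have "\<bar>(p - y) \<bullet> w i\<bar> \<le> 3 * r / 2 * \<bar>K\<bar>" if "i \<in> I" for i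
    proof -
      have "\<bar>(p - y) \<bullet> w i\<bar> \<le> norm (p - y) * norm (w i)" by (rule Cauchy_Schwarz_ineq2)
      also have "\<dots> \<le> 3 * r / 2 * \<bar>K\<bar>"
        using py wK[OF that] \<open>0 < r\<close> by (intro mult_mono) auto
      finally show ?thesis .
    qed
    then have "(\<Sum>i\<in>I. \<bar>(p - y) \<bullet> w i\<bar>) \<le> (\<Sum>i\<in>I. 3 * r / 2 * \<bar>K\<bar>)" by (rule sum_mono)
    then have "C * (\<Sum>i\<in>I. \<bar>(p - y) \<bullet> w i\<bar>) \<le> C * (m * (3 * r / 2 * \<bar>K\<bar>))"
      using \<open>0 \<le> C\<close> by (intro mult_left_mono) (auto simp: m_def)
    then have 2: "C * (\<Sum>i\<in>I. \<bar>(p - y) \<bullet> w i\<bar>) \<le> C * m * \<bar>K\<bar> * (3 * r / 2)"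
      by (simp add: algebra_simps)
    have "(r / 2)\<^sup>2 \<le> (p - y) \<bullet> (p - y)"
      unfolding power2_norm_eq_inner[symmetric] using py \<open>0 < r\<close> by (intro power_mono) auto
    then have "c * (r / 2)\<^sup>2 \<le> c * ((p - y) \<bullet> (p - y))" using \<open>0 < c\<close> by simp
    also note well[of "p - y"]
    finally have "2 * \<alpha> * (c * (r / 2)\<^sup>2) \<le> 2 * \<alpha> * (\<Sum>i\<in>I. ((p - y) \<bullet> w i)\<^sup>2)"
      using \<open>0 < \<alpha>\<close> by simp
    moreover have "2 * \<alpha> * (c * (r / 2)\<^sup>2) = L + 1"
      using \<open>0 < c\<close> \<open>0 < r\<close> by (simp add: \<alpha>_def field_simps)
    ultimately have "(\<Sum>i\<in>I. w i \<bullet> w i) - 2 * \<alpha> * (\<Sum>i\<in>I. ((p - y) \<bullet> w i)\<^sup>2)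
      + C * (\<Sum>i\<in>I. \<bar>(p - y) \<bullet> w i\<bar>) < 0"
      using 1 2 by (simp add: L_def)
    moreover have "0 < 2 * \<alpha> * \<epsilon> * E p" using \<open>0 < \<alpha>\<close> \<open>0 < \<epsilon>\<close> E_pos[of p] by simp
    ultimately show ?thesis by (rule mult_pos_neg[rotated])
  qed
  finally show False using wsub by simp
qed

section \<open>Principal frames\<close>

lemma orthonormal_expansion_3:
  fixes x e1 e2 n :: "real^3"
  assumes "norm e1 = 1" "norm e2 = 1" "norm n = 1" "e1 \<bullet> e2 = 0" "e1 \<bullet> n = 0" "e2 \<bullet> n = 0"
  shows "x = (x \<bullet> e1) *\<^sub>R e1 + (x \<bullet> e2) *\<^sub>R e2 + (x \<bullet> n) *\<^sub>R n"
proof -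
  have ne: "e1 \<noteq> e2" "e1 \<noteq> n" "e2 \<noteq> n" "e1 \<noteq> 0" "e2 \<noteq> 0" "n \<noteq> 0" using assms by auto
  have orth: "pairwise orthogonal {e1, e2, n}"
    using assms by (auto simp: pairwise_def orthogonal_def inner_commute)
  have "independent {e1, e2, n}"
    using pairwise_orthogonal_independent[OF orth] ne by auto
  moreover have "card {e1, e2, n} = 3" using ne by simp
  ultimately have "x \<in> span {e1, e2, n}"
    using card_ge_dim_independent[of "{e1, e2, n}" UNIV] by auto
  moreover have "norm i = 1" if "i \<in> {e1, e2, n}" for i using that assms by auto
  ultimately show ?thesis
    using orthonormal_basis_expand[OF orth, of x] ne by (simp add: add.assoc)
qed

definition principal_frame ::
  "(real^2 \<Rightarrow> real^3) \<Rightarrow> (real^2 \<Rightarrow> real^3) \<Rightarrow> real^2 \<Rightarrow> real^2 \<Rightarrow> real \<Rightarrow> real \<Rightarrow> bool" where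
  "principal_frame df dn w1 w2 k1 k2 \<longleftrightarrow>
     norm (df w1) = 1 \<and> norm (df w2) = 1 \<and> df w1 \<bullet> df w2 = 0
     \<and> - dn w1 = k1 *\<^sub>R df w1 \<and> - dn w2 = k2 *\<^sub>R df w2"

text \<open>The linear algebra of an immersion at one point: \<open>df\<close> is its differential, \<open>n\<close> its unit normal and
  \<open>dn\<close> the differential of the normal. The last assumption says that the shape operator is
  self-adjoint.\<close>

locale tangent_data =
  fixes df dn :: "real^2 \<Rightarrow> real^3" and n :: "real^3"
  assumes linear_df: "linear df" and linear_dn: "linear dn" and inj_df: "inj df"
    and norm_n: "norm n = 1"
    and df_n: "df v \<bullet> n = 0" and dn_n: "dn v \<bullet> n = 0"
    and self_adjoint: "dn v \<bullet> df w = dn w \<bullet> df v"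
begin

sublocale df: linear df by (rule linear_df)
sublocale dn: linear dn by (rule linear_dn)

context
  fixes w1 w2
  assumes orthonormal: "norm (df w1) = 1" "norm (df w2) = 1" "df w1 \<bullet> df w2 = 0"
begin

lemma expansion:
  "x = (x \<bullet> df w1) *\<^sub>R df w1 + (x \<bullet> df w2) *\<^sub>R df w2 + (x \<bullet> n) *\<^sub>R n"
  by (rule orthonormal_expansion_3) (simp_all add: orthonormal df_n norm_n)

lemma domain_expansion: "v = (df v \<bullet> df w1) *\<^sub>R w1 + (df v \<bullet> df w2) *\<^sub>R w2"
  using expansion[of "df v"] by (intro injD[OF inj_df]) (simp add: df_n df.add df.scale)

lemma norm_expansion: "(norm x)\<^sup>2 = (x \<bullet> df w1)\<^sup>2 + (x \<bullet> df w2)\<^sup>2 + (x \<bullet> n)\<^sup>2"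
proof -
  have "x \<bullet> x = x \<bullet> ((x \<bullet> df w1) *\<^sub>R df w1 + (x \<bullet> df w2) *\<^sub>R df w2 + (x \<bullet> n) *\<^sub>R n)"
    using expansion[of x] by simp
  then show ?thesis unfolding power2_norm_eq_inner
    by (simp add: inner_add_right power2_eq_square)
qed

text \<open>The ellipticity needed for the maximum principle. The coefficients of \<open>\<xi>\<close> in the basis \<open>w1\<close>, \<open>w2\<close>
  are those of \<open>df \<xi>\<close> in an orthonormal basis, so their length is at most \<open>b * norm \<xi>\<close>; now apply the
  Cauchy-Schwarz inequality to \<open>\<xi> \<bullet> \<xi>\<close>, with one factor expanded in this basis.\<close>

lemma frame_elliptic:
  assumes bound: "\<And>v. norm (df v) \<le> b * norm v"
  shows "\<xi> \<bullet> \<xi> \<le> b\<^sup>2 * ((\<xi> \<bullet> w1)\<^sup>2 + (\<xi> \<bullet> w2)\<^sup>2)"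
proof (cases "\<xi> = 0")
  case False
  define a1 a2 where "a1 = df \<xi> \<bullet> df w1" and "a2 = df \<xi> \<bullet> df w2"
  define q where "q = (\<xi> \<bullet> w1)\<^sup>2 + (\<xi> \<bullet> w2)\<^sup>2"
  have "\<xi> \<bullet> \<xi> = \<xi> \<bullet> (a1 *\<^sub>R w1 + a2 *\<^sub>R w2)"
    using domain_expansion[of \<xi>] by (simp add: a1_def a2_def)
  then have "\<xi> \<bullet> \<xi> = a1 * (\<xi> \<bullet> w1) + a2 * (\<xi> \<bullet> w2)" by (simp add: inner_add_right)
  moreover have "(a1 * (\<xi> \<bullet> w1) + a2 * (\<xi> \<bullet> w2))\<^sup>2 + (a1 * (\<xi> \<bullet> w2) - a2 * (\<xi> \<bullet> w1))\<^sup>2 = (a1\<^sup>2 + a2\<^sup>2) * q"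
    by (simp add: q_def power2_eq_square algebra_simps)
  ultimately have "(\<xi> \<bullet> \<xi>)\<^sup>2 \<le> (a1\<^sup>2 + a2\<^sup>2) * q"
    by (metis le_add_same_cancel1 zero_le_power2)
  also have "a1\<^sup>2 + a2\<^sup>2 = (norm (df \<xi>))\<^sup>2"
    using norm_expansion[of "df \<xi>"] by (simp add: a1_def a2_def df_n)
  also have "\<dots> * q \<le> (b * norm \<xi>)\<^sup>2 * q"
    by (intro mult_right_mono power_mono bound) (auto simp: q_def)
  also have "\<dots> = (\<xi> \<bullet> \<xi>) * (b\<^sup>2 * q)"
    by (simp add: power_mult_distrib power2_norm_eq_inner)
  finally show ?thesis using False by (simp add: power2_eq_square q_def)
qed simp

text \<open>For unit vectors, \<open>norm (n - n0)\<close> squared is \<open>2 - 2 * (n \<bullet> n0)\<close>, at most twice the squared length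
  \<open>1 - (d \<bullet> n)\<^sup>2\<close> of the tangential part of \<open>d\<close> as long as \<open>n\<close> and \<open>n0\<close> lie in one closed
  half-space. In the application the right-hand side is the derivative of a height function, so this
  turns a bound in terms of the normal into a first-order term.\<close>

lemma norm_normal_diff_le:
  assumes "norm d = 1" "n0 = d \<or> n0 = - d" "0 \<le> n \<bullet> n0"
  shows "norm (n - n0) \<le> 2 * (\<bar>d \<bullet> df w1\<bar> + \<bar>d \<bullet> df w2\<bar>)"
proof -
  have n0: "norm n0 = 1" "(d \<bullet> n)\<^sup>2 = (n \<bullet> n0)\<^sup>2" using assms(1,2) by (auto simp: inner_commute)
  have "n \<bullet> n0 \<le> 1" using norm_cauchy_schwarz[of n n0] n0 norm_n by simp
  then have sq: "(n \<bullet> n0)\<^sup>2 \<le> n \<bullet> n0" using assms(3) by (simp add: power2_eq_square mult_left_le)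
  have "(norm (n - n0))\<^sup>2 = 2 - 2 * (n \<bullet> n0)"
    using norm_n n0 by (simp add: power2_norm_eq_inner inner_simps inner_commute flip: norm_eq_1)
      (simp add: norm_eq_1)
  also have "\<dots> \<le> 2 * (1 - (d \<bullet> n)\<^sup>2)" using sq n0 by simp
  also have "\<dots> = 2 * ((d \<bullet> df w1)\<^sup>2 + (d \<bullet> df w2)\<^sup>2)"
    using norm_expansion[of d] assms(1) by simp
  also have "\<dots> \<le> (2 * (\<bar>d \<bullet> df w1\<bar> + \<bar>d \<bullet> df w2\<bar>))\<^sup>2"
    by (simp add: power2_sum power_mult_distrib)
  finally show ?thesis by (rule power2_le_imp_le) simp
qed

end

text \<open>The trace of the shape operator in two orthonormal frames; it makes the mean curvature independent
  of the chosen frame.\<close>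

lemma trace_eq:
  assumes W: "norm (df w1) = 1" "norm (df w2) = 1" "df w1 \<bullet> df w2 = 0"
    and U: "norm (df u1) = 1" "norm (df u2) = 1" "df u1 \<bullet> df u2 = 0"
  shows "dn w1 \<bullet> df w1 + dn w2 \<bullet> df w2 = dn u1 \<bullet> df u1 + dn u2 \<bullet> df u2"
proof -
  have u: "dn v = (df v \<bullet> df w1) *\<^sub>R dn w1 + (df v \<bullet> df w2) *\<^sub>R dn w2" for v
    using arg_cong[OF domain_expansion[OF W, of v], of dn] by (simp add: dn.add dn.scale)
  have w: "df v = (df v \<bullet> df u1) *\<^sub>R df u1 + (df v \<bullet> df u2) *\<^sub>R df u2" for v
    using expansion[OF U, of "df v"] by (simp add: df_n)
  have "dn w1 \<bullet> df w1 + dn w2 \<bullet> df w2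
      = dn w1 \<bullet> ((df w1 \<bullet> df u1) *\<^sub>R df u1 + (df w1 \<bullet> df u2) *\<^sub>R df u2)
      + dn w2 \<bullet> ((df w2 \<bullet> df u1) *\<^sub>R df u1 + (df w2 \<bullet> df u2) *\<^sub>R df u2)"
    using w[of w1] w[of w2] by simp
  also have "\<dots> = ((df u1 \<bullet> df w1) *\<^sub>R dn w1 + (df u1 \<bullet> df w2) *\<^sub>R dn w2) \<bullet> df u1
      + ((df u2 \<bullet> df w1) *\<^sub>R dn w1 + (df u2 \<bullet> df w2) *\<^sub>R dn w2) \<bullet> df u2"
    by (simp add: inner_add_left inner_add_right inner_commute)
  also have "\<dots> = dn u1 \<bullet> df u1 + dn u2 \<bullet> df u2"
    using u[of u1] u[of u2] by simp
  finally show ?thesis .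
qed

lemma ex_orthonormal_frame:
  obtains w1 w2 where "norm (df w1) = 1" "norm (df w2) = 1" "df w1 \<bullet> df w2 = 0"
proof -
  obtain B where B: "B \<subseteq> range df" "pairwise orthogonal B" "\<And>x. x \<in> B \<Longrightarrow> norm x = 1"
      "card B = dim (range df)"
    using orthonormal_basis_subspace[of "range df"] linear_subspace_image[OF linear_df subspace_UNIV] by metis
  have "dim (range df) = 2"
    using dim_image_eq[OF linear_df, of UNIV] inj_df by simp
  with B(4) obtain b1 b2 where b: "B = {b1, b2}" "b1 \<noteq> b2" by (auto simp: card_2_iff)
  with B obtain w1 w2 where "df w1 = b1" "df w2 = b2" by auto
  with b B show ?thesis by (intro that[of w1 w2]) (auto simp: pairwise_def orthogonal_def)
qed

text \<open>The principal axis theorem in dimension two: rotate an orthonormal frame by an angle \<open>t\<close>. The mixed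
  entry \<open>g t\<close> of the second fundamental form changes its sign between \<open>0\<close> and \<open>pi / 2\<close>, so it vanishes
  in between.\<close>

lemma ex_principal_frame: "\<exists>w1 w2 k1 k2. principal_frame df dn w1 w2 k1 k2"
proof -
  obtain a1 a2 where a: "norm (df a1) = 1" "norm (df a2) = 1" "df a1 \<bullet> df a2 = 0"
    by (rule ex_orthonormal_frame)
  have aa: "df a1 \<bullet> df a1 = 1" "df a2 \<bullet> df a2 = 1" using a by (simp_all add: norm_eq_1)
  define \<beta>11 \<beta>12 \<beta>22 where "\<beta>11 = dn a1 \<bullet> df a1" and "\<beta>12 = dn a1 \<bullet> df a2" and "\<beta>22 = dn a2 \<bullet> df a2"
  define g where "g t = \<beta>12 * cos (2 * t) + (\<beta>22 - \<beta>11) / 2 * sin (2 * t)" for t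
  have "continuous_on {0..pi/2} g" unfolding g_def by (intro continuous_intros)
  moreover have "g 0 = \<beta>12" "g (pi/2) = - \<beta>12" by (simp_all add: g_def)
  ultimately obtain t where t: "g t = 0"
    using IVT'[of g 0 0 "pi/2"] IVT2'[of g "pi/2" 0 0] by (cases "\<beta>12 \<le> 0") auto
  define w1 w2 where "w1 = cos t *\<^sub>R a1 + sin t *\<^sub>R a2" and "w2 = - sin t *\<^sub>R a1 + cos t *\<^sub>R a2"
  have w: "df w1 = cos t *\<^sub>R df a1 + sin t *\<^sub>R df a2" "df w2 = - sin t *\<^sub>R df a1 + cos t *\<^sub>R df a2"
    "dn w1 = cos t *\<^sub>R dn a1 + sin t *\<^sub>R dn a2"
    by (simp_all add: w1_def w2_def df.add df.scale df.diff df.neg dn.add dn.scale)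
  have "df w1 \<bullet> df w1 = 1" "df w2 \<bullet> df w2 = 1" "df w1 \<bullet> df w2 = 0"
    using aa a(3) a(3)[unfolded inner_commute[of "df a1"]] sin_cos_squared_add3[of t]
    by (simp_all add: w inner_simps)
  then have on: "norm (df w1) = 1" "norm (df w2) = 1" "df w1 \<bullet> df w2 = 0" by (auto simp: norm_eq_1)
  have "dn a2 \<bullet> df a1 = \<beta>12" by (simp add: \<beta>12_def self_adjoint)
  then have "dn w1 \<bullet> df w2 = \<beta>12 * ((cos t)\<^sup>2 - (sin t)\<^sup>2) + (\<beta>22 - \<beta>11) * (sin t * cos t)"
    by (simp add: w inner_simps \<beta>11_def \<beta>12_def \<beta>22_def power2_eq_square algebra_simps)
  also have "\<dots> = g t" by (simp add: g_def cos_double sin_double)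
  finally have "dn w1 \<bullet> df w2 = 0" "dn w2 \<bullet> df w1 = 0" using t self_adjoint[of w1 w2] by auto
  then have "dn w1 = (dn w1 \<bullet> df w1) *\<^sub>R df w1" "dn w2 = (dn w2 \<bullet> df w2) *\<^sub>R df w2"
    using expansion[OF on, of "dn w1"] expansion[OF on, of "dn w2"] by (simp_all add: dn_n)
  then have "principal_frame df dn w1 w2 (- (dn w1 \<bullet> df w1)) (- (dn w2 \<bullet> df w2))"
    using on by (simp add: principal_frame_def)
  then show ?thesis by blast
qed

lemma principal_frame_trace:
  assumes "principal_frame df dn w1 w2 k1 k2"
  shows "dn w1 \<bullet> df w1 + dn w2 \<bullet> df w2 = - (k1 + k2)"
proof -
  have "dn w1 = - k1 *\<^sub>R df w1" "dn w2 = - k2 *\<^sub>R df w2"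
    using assms unfolding principal_frame_def by (metis minus_minus scaleR_minus_left)+
  moreover have "df w1 \<bullet> df w1 = 1" "df w2 \<bullet> df w2 = 1"
    using assms by (simp_all add: principal_frame_def norm_eq_1)
  ultimately show ?thesis by simp
qed

lemma principal_frame_sum_unique:
  assumes "principal_frame df dn w1 w2 k1 k2" "principal_frame df dn u1 u2 l1 l2"
  shows "k1 + k2 = l1 + l2"
proof -
  have "dn w1 \<bullet> df w1 + dn w2 \<bullet> df w2 = dn u1 \<bullet> df u1 + dn u2 \<bullet> df u2"
    using assms by (intro trace_eq) (auto simp: principal_frame_def)
  then show ?thesis using assms[THEN principal_frame_trace] by simp
qed

end

section \<open>Parametrized surfaces\<close>

lemma smooth_on_has_derivative:
  assumes "smooth_on f S" "x \<in> S"
  shows "(f has_derivative frechet_derivative f (at x)) (at x)"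
proof -
  have "C_k_on (Suc 0) f S" using assms by (simp only: smooth_on_def)
  then show ?thesis using assms by (simp add: frechet_derivative_works)
qed

lemma smooth_on_continuous: "smooth_on f S \<Longrightarrow> continuous_on S f"
  unfolding smooth_on_def by (metis C_k_on.simps(1))

lemma smooth_on_frechet_derivative:
  assumes "smooth_on f S"
  shows "smooth_on (\<lambda>x. frechet_derivative f (at x) v) S"
  unfolding smooth_on_def
proof
  fix k have "C_k_on (Suc k) f S" using assms by (simp only: smooth_on_def)
  then show "C_k_on k (\<lambda>x. frechet_derivative f (at x) v) S" by simp
qed

lemma linear_on_plane:
  assumes "linear (f :: real^2 \<Rightarrow> 'b::real_vector)"
  shows "f v = (v $ 1) *\<^sub>R f (axis 1 1) + (v $ 2) *\<^sub>R f (axis 2 1)"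
proof -
  interpret linear f by (rule assms)
  have "v = (v $ 1) *\<^sub>R axis 1 1 + (v $ 2) *\<^sub>R axis 2 1"
    by (simp add: vec_eq_iff forall_2 axis_def)
  then have "f v = f ((v $ 1) *\<^sub>R axis 1 1 + (v $ 2) *\<^sub>R axis 2 1)" by simp
  then show ?thesis by (simp add: add scale)
qed

text \<open>\<open>C_k_on\<close> gives continuity of a derivative for each fixed direction only. Uniform bounds need joint
  continuity in the point and the direction.\<close>

lemma continuous_on_linear_family:
  fixes T :: "'a::topological_space \<Rightarrow> real^2 \<Rightarrow> 'b::real_normed_vector"
  assumes "\<And>u. u \<in> S \<Longrightarrow> linear (T u)" and "\<And>v. continuous_on S (\<lambda>u. T u v)"
  shows "continuous_on (S \<times> UNIV) (\<lambda>p. T (fst p) (snd p))"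
proof -
  have fst: "continuous_on (S \<times> UNIV) (\<lambda>p::'a\<times>(real^2). T (fst p) v)" for v
    by (rule continuous_on_compose2[OF assms(2)]) (auto intro: continuous_intros)
  have "continuous_on (S \<times> UNIV) (\<lambda>p::'a\<times>(real^2).
      (snd p $ 1) *\<^sub>R T (fst p) (axis 1 1) + (snd p $ 2) *\<^sub>R T (fst p) (axis 2 1))"
    by (intro continuous_intros fst)
  then show ?thesis
    by (rule continuous_on_eq) (auto intro!: linear_on_plane[symmetric] assms(1))
qed

locale parametrized_surface =
  fixes V :: "(real^2) set" and F G :: "real^2 \<Rightarrow> real^3"
  assumes open_V: "open V"
    and smooth_F: "smooth_on F V"
    and immersive: "u \<in> V \<Longrightarrow> inj (frechet_derivative F (at u))"
    and smooth_G: "smooth_on G V"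
    and norm_G: "u \<in> V \<Longrightarrow> norm (G u) = 1"
    and normal_G: "u \<in> V \<Longrightarrow> G u \<bullet> frechet_derivative F (at u) v = 0"
begin

abbreviation DF where "DF u \<equiv> frechet_derivative F (at u)"
abbreviation DG where "DG u \<equiv> frechet_derivative G (at u)"
abbreviation D2F where "D2F u v \<equiv> frechet_derivative (\<lambda>x. DF x v) (at u)"

lemmas F_has_derivative = smooth_on_has_derivative[OF smooth_F]
lemmas G_has_derivative = smooth_on_has_derivative[OF smooth_G]
lemmas DF_has_derivative = smooth_on_has_derivative[OF smooth_on_frechet_derivative[OF smooth_F]]

lemma height_has_derivative:
  assumes "u \<in> V"
  shows "((\<lambda>u. d \<bullet> F u) has_derivative (\<lambda>v. d \<bullet> DF u v)) (at u)"
    and "((\<lambda>u. d \<bullet> DF u v) has_derivative (\<lambda>w. d \<bullet> D2F u v w)) (at u)"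
  by (rule has_derivative_inner_right[OF F_has_derivative[OF assms]],
      rule has_derivative_inner_right[OF DF_has_derivative[OF assms]])

text \<open>Needed for the self-adjointness of the shape operator, which Weingarten's equation
  reduces to it.\<close>

lemma D2F_symmetric:
  assumes "u \<in> V"
  shows "D2F u v w = D2F u w v"
proof (subst vector_eq_rdot[symmetric], rule allI, subst (1 2) inner_commute)
  fix d show "d \<bullet> D2F u v w = d \<bullet> D2F u w v"
    by (rule second_derivative_symmetric[OF open_V assms height_has_derivative(1)
          height_has_derivative(2)[OF assms]])
qed

text \<open>Differentiate \<open>G \<bullet> DF v = 0\<close>.\<close>

lemma Weingarten:
  assumes "u \<in> V"
  shows "DG u w \<bullet> DF u v = - (G u \<bullet> D2F u v w)"
proof -
  have "((\<lambda>x. G x \<bullet> DF x v) has_derivative (\<lambda>w. G u \<bullet> D2F u v w + DG u w \<bullet> DF u v)) (at u)"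
    by (intro has_derivative_inner G_has_derivative DF_has_derivative assms)
  moreover have "((\<lambda>x. G x \<bullet> DF x v) has_derivative (\<lambda>w. 0)) (at u)"
    by (rule has_derivative_transform_within_open[OF has_derivative_const open_V assms, of 0])
      (simp add: normal_G)
  ultimately have "(\<lambda>w. G u \<bullet> D2F u v w + DG u w \<bullet> DF u v) = (\<lambda>w. 0)"
    by (rule has_derivative_unique)
  from fun_cong[OF this, of w] show ?thesis by simp
qed

lemma DG_tangent:
  assumes "u \<in> V"
  shows "DG u w \<bullet> G u = 0"
proof -
  have "((\<lambda>x. G x \<bullet> G x) has_derivative (\<lambda>w. G u \<bullet> DG u w + DG u w \<bullet> G u)) (at u)"
    by (intro has_derivative_inner G_has_derivative assms)
  moreover have "((\<lambda>x. G x \<bullet> G x) has_derivative (\<lambda>w. 0)) (at u)"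
    by (rule has_derivative_transform_within_open[OF has_derivative_const open_V assms, of 1])
      (use norm_G in \<open>simp add: norm_eq_1\<close>)
  ultimately have "(\<lambda>w. G u \<bullet> DG u w + DG u w \<bullet> G u) = (\<lambda>w. 0)"
    by (rule has_derivative_unique)
  from fun_cong[OF this, of w] show ?thesis by (simp add: inner_commute)
qed

lemma tangent_data_at:
  assumes "u \<in> V"
  shows "tangent_data (DF u) (DG u) (G u)"
proof (rule tangent_data.intro)
  show "linear (DF u)" by (rule has_derivative_linear[OF F_has_derivative[OF assms]])
  show "linear (DG u)" by (rule has_derivative_linear[OF G_has_derivative[OF assms]])
  show "inj (DF u)" by (rule immersive[OF assms])
  show "norm (G u) = 1" by (rule norm_G[OF assms])
  show "DG u v \<bullet> DF u w = DG u w \<bullet> DF u v" for v w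
    unfolding Weingarten[OF assms] by (subst D2F_symmetric[OF assms]) (rule refl)
  show "DF u v \<bullet> G u = 0" for v using normal_G[OF assms] by (subst inner_commute)
  show "DG u v \<bullet> G u = 0" for v by (rule DG_tangent[OF assms])
qed

lemma normal_curvature_sum:
  assumes "u \<in> V" "principal_frame (DF u) (DG u) w1 w2 k1 k2"
  shows "G u \<bullet> (D2F u w1 w1 + D2F u w2 w2) = k1 + k2"
  using tangent_data.principal_frame_trace[OF tangent_data_at[OF assms(1)] assms(2)]
  unfolding Weingarten[OF assms(1)] inner_add_right by linarith

lemma continuous_DF: "continuous_on (V \<times> UNIV) (\<lambda>p. DF (fst p) (snd p))"
  by (rule continuous_on_linear_family[OF has_derivative_linear[OF F_has_derivative]
        smooth_on_continuous[OF smooth_on_frechet_derivative[OF smooth_F]]])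

lemma continuous_D2F_diagonal: "continuous_on (V \<times> UNIV) (\<lambda>p. D2F (fst p) (snd p) (snd p))"
proof -
  have D2F: "continuous_on (V \<times> UNIV) (\<lambda>p. D2F (fst p) v (snd p))" for v
    by (rule continuous_on_linear_family[OF has_derivative_linear[OF DF_has_derivative]
        smooth_on_continuous[OF smooth_on_frechet_derivative[OF smooth_on_frechet_derivative[OF smooth_F]]]])
  have "continuous_on (V \<times> UNIV) (\<lambda>p::(real^2)\<times>(real^2).
      (snd p $ 1) *\<^sub>R D2F (fst p) (axis 1 1) (snd p) + (snd p $ 2) *\<^sub>R D2F (fst p) (axis 2 1) (snd p))"
    by (intro continuous_intros D2F)
  then show ?thesis
  proof (rule continuous_on_eq)
    fix p :: "(real^2)\<times>(real^2)" assume "p \<in> V \<times> UNIV"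
    then have u: "fst p \<in> V" by auto
    show "(snd p $ 1) *\<^sub>R D2F (fst p) (axis 1 1) (snd p) + (snd p $ 2) *\<^sub>R D2F (fst p) (axis 2 1) (snd p)
        = D2F (fst p) (snd p) (snd p)"
      unfolding D2F_symmetric[OF u, of "axis 1 1" "snd p"] D2F_symmetric[OF u, of "axis 2 1" "snd p"]
      by (rule linear_on_plane[OF has_derivative_linear[OF DF_has_derivative[OF u]], symmetric])
  qed
qed

text \<open>On compact sets the first fundamental form is comparable with the Euclidean metric. The bounds hold
  on the compact set of unit vectors and extend to all vectors by homogeneity.\<close>

lemma DF_bounds:
  assumes "compact K" "K \<subseteq> V"
  obtains a b where "0 < a" "0 < b" "\<And>u v. u \<in> K \<Longrightarrow> a * norm v \<le> norm (DF u v)"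
    "\<And>u v. u \<in> K \<Longrightarrow> norm (DF u v) \<le> b * norm v"
proof (cases "K = {}")
  case False
  define Q where "Q = K \<times> sphere (0::real^2) 1"
  have "sphere (0::real^2) 1 \<noteq> {}" by simp
  then have Q: "compact Q" "Q \<noteq> {}" using assms False by (auto simp: Q_def intro: compact_Times)
  have cont: "continuous_on Q (\<lambda>p. norm (DF (fst p) (snd p)))"
    using assms(2) by (intro continuous_on_norm continuous_on_subset[OF continuous_DF]) (auto simp: Q_def)
  obtain p where p: "p \<in> Q" "\<And>q. q \<in> Q \<Longrightarrow> norm (DF (fst p) (snd p)) \<le> norm (DF (fst q) (snd q))"
    using continuous_attains_inf[OF Q cont] by auto
  obtain r where r: "r \<in> Q" "\<And>q. q \<in> Q \<Longrightarrow> norm (DF (fst q) (snd q)) \<le> norm (DF (fst r) (snd r))"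
    using continuous_attains_sup[OF Q cont] by auto
  define a b where "a = norm (DF (fst p) (snd p))" and "b = norm (DF (fst r) (snd r))"
  have "fst p \<in> V" "snd p \<noteq> 0" using p(1) assms(2) by (auto simp: Q_def)
  then have "DF (fst p) (snd p) \<noteq> 0"
    using immersive[of "fst p"] has_derivative_linear[OF F_has_derivative] linear_injective_0 by blast
  then have "0 < a" by (simp add: a_def)
  moreover have "a \<le> b" using p(2)[OF r(1)] by (simp add: a_def b_def)
  moreover have "a * norm v \<le> norm (DF u v) \<and> norm (DF u v) \<le> b * norm v" if u: "u \<in> K" for u v
  proof (cases "v = 0")
    case True
    then show ?thesis using linear_0[OF has_derivative_linear[OF F_has_derivative]] u assms(2) by auto
  next
    case False
    then have "(u, v /\<^sub>R norm v) \<in> Q" using u by (simp add: Q_def)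
    then have "a \<le> norm (DF u (v /\<^sub>R norm v))" "norm (DF u (v /\<^sub>R norm v)) \<le> b"
      using p(2) r(2) by (fastforce simp: a_def b_def)+
    moreover have "DF u (v /\<^sub>R norm v) = DF u v /\<^sub>R norm v"
      using linear_scale[OF has_derivative_linear[OF F_has_derivative]] u assms(2) by blast
    ultimately show ?thesis using False by (simp add: field_simps)
  qed
  ultimately show ?thesis by (intro that[of a b]) auto
next
  case True
  then show ?thesis by (intro that[of 1 1]) simp_all
qed

lemma D2F_bound:
  assumes "compact K" "K \<subseteq> V"
  obtains b where "0 \<le> b" "\<And>u v. u \<in> K \<Longrightarrow> norm v \<le> r \<Longrightarrow> norm (D2F u v v) \<le> b"
proof -
  have "continuous_on (K \<times> cball 0 r) (\<lambda>p. D2F (fst p) (snd p) (snd p))"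
    using assms(2) by (intro continuous_on_subset[OF continuous_D2F_diagonal]) auto
  then have "bounded ((\<lambda>p. D2F (fst p) (snd p) (snd p)) ` (K \<times> cball 0 r))"
    by (intro compact_imp_bounded compact_continuous_image compact_Times assms compact_cball)
  then obtain b where b: "\<And>p. p \<in> K \<times> cball 0 r \<Longrightarrow> norm (D2F (fst p) (snd p) (snd p)) \<le> b"
    unfolding bounded_iff by blast
  show ?thesis
  proof (rule that)
    show "norm (D2F u v v) \<le> max 0 b" if "u \<in> K" "norm v \<le> r" for u v
      using b[of "(u, v)"] that by simp
  qed simp
qed

lemma critical_height_normal:
  assumes "u \<in> V" "norm d = 1" "\<And>v. d \<bullet> DF u v = 0"
  shows "G u = d \<or> G u = - d"
proof -
  interpret tangent_data "DF u" "DG u" "G u" by (rule tangent_data_at[OF assms(1)])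
  obtain w1 w2 where w: "norm (DF u w1) = 1" "norm (DF u w2) = 1" "DF u w1 \<bullet> DF u w2 = 0"
    by (rule ex_orthonormal_frame)
  have d: "d = (d \<bullet> G u) *\<^sub>R G u" using expansion[OF w, of d] assms(3) by simp
  then have "\<bar>d \<bullet> G u\<bar> = 1" using assms(2) norm_n by (metis mult.right_neutral norm_scaleR)
  then show ?thesis using d by (cases "0 \<le> d \<bullet> G u") (auto simp: abs_if)
qed

text \<open>At a maximum of \<open>d \<bullet> F\<close> the second derivatives are nonpositive, and their sum along a principal frame
  is \<open>k1 + k2\<close> up to the sign that relates \<open>d\<close> to the normal.\<close>

lemma maximal_height:
  assumes u: "u \<in> V" and d: "norm d = 1" and max: "\<And>x. x \<in> V \<Longrightarrow> d \<bullet> F x \<le> d \<bullet> F u"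
    and frame: "principal_frame (DF u) (DG u) w1 w2 k1 k2"
  shows "(G u = d \<and> k1 + k2 \<le> 0) \<or> (G u = - d \<and> 0 \<le> k1 + k2)"
proof -
  note critical = interior_maximum_derivatives[OF open_V u height_has_derivative(1)
      height_has_derivative(2)[OF u] max]
  have "d \<bullet> DF u v = 0" for v by (rule critical(1))
  moreover have D2: "d \<bullet> D2F u v v \<le> 0" for v by (rule critical(2))
  ultimately have "G u = d \<or> G u = - d" by (intro critical_height_normal u d)
  then show ?thesis
    using normal_curvature_sum[OF u frame] D2[of w1] D2[of w2] by (auto simp: inner_add_right)
qed

text \<open>Touching a plane from one side, in a parametrization. The height \<open>d \<bullet> F\<close> satisfies the
  hypotheses of the strong maximum principle near \<open>u0\<close>. Once it is constant there, its derivative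
  vanishes, and the bound for \<open>G u - n0\<close> by this derivative makes the normal constant as well.\<close>

lemma maximal_height_rigidity:
  assumes u0: "u0 \<in> V" and d: "norm d = 1" "n0 = d \<or> n0 = - d" and G0: "G u0 = n0"
    and mean: "\<And>u w1 w2 k1 k2. u \<in> V \<Longrightarrow> principal_frame (DF u) (DG u) w1 w2 k1 k2 \<Longrightarrow>
       (k1 + k2) / 2 = \<H> (G u)"
    and lip: "0 < \<delta>" "0 \<le> L"
       "\<And>y. norm y = 1 \<Longrightarrow> norm (y - n0) < \<delta> \<Longrightarrow> \<bar>\<H> y\<bar> \<le> L * norm (y - n0)"
    and max: "\<And>u. u \<in> V \<Longrightarrow> d \<bullet> F u \<le> d \<bullet> F u0"
  shows "\<exists>U. open U \<and> u0 \<in> U \<and> U \<subseteq> V \<and> (\<forall>u\<in>U. d \<bullet> F u = d \<bullet> F u0 \<and> G u = n0)"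
proof -
  have n0: "norm n0 = 1" using d by auto
  obtain r1 where r1: "0 < r1" "cball u0 r1 \<subseteq> V" using open_V u0 open_contains_cball by blast
  obtain r2 where r2: "0 < r2" "\<And>u. u \<in> V \<Longrightarrow> dist u u0 < r2 \<Longrightarrow> dist (G u) (G u0) < min \<delta> 1"
    using smooth_on_continuous[OF smooth_G] u0 lip(1) unfolding continuous_on_iff
    by (metis min_less_iff_conj zero_less_one)
  define R where "R = min r1 (r2 / 2)"
  have R: "0 < R" "cball u0 R \<subseteq> V" using r1 r2 by (auto simp: R_def)
  have near: "norm (G u - n0) < \<delta>" "0 \<le> G u \<bullet> n0" if "u \<in> cball u0 R" for u
  proof -
    have "u \<in> V" "dist u u0 < r2" using that R r2(1) by (auto simp: R_def dist_commute)
    from r2(2)[OF this] have *: "norm (G u - n0) < \<delta>" "norm (G u - n0) < 1"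
      by (simp_all add: G0 dist_norm)
    then show "norm (G u - n0) < \<delta>" by simp
    have "(norm (G u - n0))\<^sup>2 \<le> 1" using *(2) by (simp add: power_le_one)
    moreover have "(norm (G u - n0))\<^sup>2 = 2 - 2 * (G u \<bullet> n0)"
      using norm_G[OF \<open>u \<in> V\<close>] n0 by (simp add: power2_norm_eq_inner inner_simps inner_commute norm_eq_1)
    ultimately show "0 \<le> G u \<bullet> n0" by simp
  qed
  obtain a b where ab: "0 < a" "0 < b" "\<And>u v. u \<in> cball u0 R \<Longrightarrow> a * norm v \<le> norm (DF u v)"
    "\<And>u v. u \<in> cball u0 R \<Longrightarrow> norm (DF u v) \<le> b * norm v"
    using DF_bounds[OF compact_cball R(2)] by blast
  obtain B where B: "0 \<le> B" "\<And>u v. u \<in> cball u0 R \<Longrightarrow> norm v \<le> 1 / a \<Longrightarrow> norm (D2F u v v) \<le> B"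
    using D2F_bound[OF compact_cball R(2), of "1 / a"] by blast
  \<comment> \<open>The part \<open>2 * B\<close> comes from the tangential component of the second derivatives, \<open>4 * L\<close> from \<open>\<H>\<close>.\<close>
  define C where "C = 2 * B + 4 * L"
  have "0 \<le> C" using B lip by (simp add: C_def)
  have sub: "\<exists>w. (\<forall>i\<in>UNIV. norm (w i) \<le> 1 / a)
        \<and> (\<forall>\<xi>. 1 / b\<^sup>2 * (\<xi> \<bullet> \<xi>) \<le> (\<Sum>i\<in>UNIV. (\<xi> \<bullet> w i)\<^sup>2))
        \<and> 0 \<le> (\<Sum>i\<in>(UNIV::bool set). d \<bullet> D2F u (w i) (w i)) + C * (\<Sum>i\<in>UNIV. \<bar>d \<bullet> DF u (w i)\<bar>)"
    if "u \<in> ball u0 R" for u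
  proof -
    have uc: "u \<in> cball u0 R" and uV: "u \<in> V" using that R(2) by auto
    interpret tangent_data "DF u" "DG u" "G u" by (rule tangent_data_at[OF uV])
    obtain w1 w2 k1 k2 where frame: "principal_frame (DF u) (DG u) w1 w2 k1 k2"
      using ex_principal_frame by blast
    then have w: "norm (DF u w1) = 1" "norm (DF u w2) = 1" "DF u w1 \<bullet> DF u w2 = 0"
      by (auto simp: principal_frame_def)
    define e where "e = \<bar>d \<bullet> DF u w1\<bar> + \<bar>d \<bullet> DF u w2\<bar>"
    define S where "S = D2F u w1 w1 + D2F u w2 w2"
    have wa: "norm w1 \<le> 1 / a" "norm w2 \<le> 1 / a"
      using ab(3)[OF uc, of w1] ab(3)[OF uc, of w2] w ab(1) by (simp_all add: field_simps)
    have S: "norm S \<le> 2 * B"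
      unfolding S_def using B(2)[OF uc wa(1)] B(2)[OF uc wa(2)] by norm
    have "\<bar>\<H> (G u)\<bar> \<le> L * norm (G u - n0)" using near[OF uc] lip norm_n by blast
    also have "\<dots> \<le> L * (2 * e)"
      unfolding e_def by (intro mult_left_mono norm_normal_diff_le w d near uc lip)
    finally have H: "\<bar>\<H> (G u)\<bar> \<le> L * (2 * e)" .
    have GS: "G u \<bullet> S = 2 * \<H> (G u)"
      using normal_curvature_sum[OF uV frame] mean[OF uV frame] by (simp add: S_def)
    \<comment> \<open>Split \<open>d\<close> into tangential and normal part: the tangential one is \<open>Dh\<close>, the normal one meets only
      the mean curvature.\<close>
    have "d \<bullet> S = ((d \<bullet> DF u w1) *\<^sub>R DF u w1 + (d \<bullet> DF u w2) *\<^sub>R DF u w2 + (d \<bullet> G u) *\<^sub>R G u) \<bullet> S"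
      using expansion[OF w, of d] by simp
    also have "\<dots> = (d \<bullet> DF u w1) * (DF u w1 \<bullet> S) + (d \<bullet> DF u w2) * (DF u w2 \<bullet> S)
        + (d \<bullet> G u) * (2 * \<H> (G u))"
      by (simp add: inner_add_left GS)
    finally have dS: "d \<bullet> S = (d \<bullet> DF u w1) * (DF u w1 \<bullet> S) + (d \<bullet> DF u w2) * (DF u w2 \<bullet> S)
        + (d \<bullet> G u) * (2 * \<H> (G u))" .
    have t: "\<bar>(d \<bullet> DF u w) * (DF u w \<bullet> S)\<bar> \<le> \<bar>d \<bullet> DF u w\<bar> * (2 * B)" if "norm (DF u w) = 1" for w
      using Cauchy_Schwarz_ineq2[of "DF u w" S] that S by (simp add: abs_mult mult_left_mono)
    have "\<bar>d \<bullet> G u\<bar> \<le> 1" using Cauchy_Schwarz_ineq2[of d "G u"] d norm_n by simp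
    then have "\<bar>(d \<bullet> G u) * (2 * \<H> (G u))\<bar> \<le> 1 * (2 * (L * (2 * e)))"
      unfolding abs_mult using H by (intro mult_mono) auto
    then have "\<bar>d \<bullet> S\<bar> \<le> \<bar>d \<bullet> DF u w1\<bar> * (2 * B) + \<bar>d \<bullet> DF u w2\<bar> * (2 * B) + 4 * L * e"
      using t[OF w(1)] t[OF w(2)] dS by linarith
    also have "\<dots> = C * e" by (simp add: C_def e_def algebra_simps)
    finally have "0 \<le> d \<bullet> S + C * e" by linarith
    moreover have "1 / b\<^sup>2 * (\<xi> \<bullet> \<xi>) \<le> (\<xi> \<bullet> w1)\<^sup>2 + (\<xi> \<bullet> w2)\<^sup>2" for \<xi>
      using frame_elliptic[OF w ab(4)[OF uc], of \<xi>] ab(2) by (simp add: field_simps)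
    ultimately show ?thesis
      using wa by (intro exI[of _ "\<lambda>i. if i then w1 else w2"])
        (simp add: UNIV_bool S_def e_def inner_add_right add_ac)
  qed
  have const: "d \<bullet> F u = d \<bullet> F u0" if "u \<in> ball u0 (R / 2)" for u
  proof (rule strong_maximum_principle[where h = "\<lambda>u. d \<bullet> F u" and Dh = "\<lambda>u v. d \<bullet> DF u v"
        and D2h = "\<lambda>u v w. d \<bullet> D2F u v w" and I = "UNIV :: bool set" and K = "1 / a"
        and c = "1 / b\<^sup>2" and C = C, OF _ _ _ \<open>0 \<le> C\<close> sub _ that])
    show "((\<lambda>u. d \<bullet> F u) has_derivative (\<lambda>v. d \<bullet> DF x v)) (at x)"
      "((\<lambda>u. d \<bullet> DF u v) has_derivative (\<lambda>w. d \<bullet> D2F x v w)) (at x)"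
      "d \<bullet> F x \<le> d \<bullet> F u0" if "x \<in> ball u0 R" for x v
    proof -
      have "x \<in> V" using that R(2) by auto
      then show "((\<lambda>u. d \<bullet> F u) has_derivative (\<lambda>v. d \<bullet> DF x v)) (at x)"
        "((\<lambda>u. d \<bullet> DF u v) has_derivative (\<lambda>w. d \<bullet> D2F x v w)) (at x)"
        "d \<bullet> F x \<le> d \<bullet> F u0"
        by (auto intro: height_has_derivative max)
    qed
  qed (use ab in auto)
  have "G u = n0" if u: "u \<in> ball u0 (R / 2)" for u
  proof -
    have uc: "u \<in> cball u0 R" and uV: "u \<in> V" using u R by auto
    interpret tangent_data "DF u" "DG u" "G u" by (rule tangent_data_at[OF uV])
    obtain w1 w2 where w: "norm (DF u w1) = 1" "norm (DF u w2) = 1" "DF u w1 \<bullet> DF u w2 = 0"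
      by (rule ex_orthonormal_frame)
    have "((\<lambda>u. d \<bullet> F u) has_derivative (\<lambda>v. 0)) (at u)"
      by (rule has_derivative_transform_within_open[OF has_derivative_const open_ball u])
        (simp add: const)
    then have "(\<lambda>v. d \<bullet> DF u v) = (\<lambda>v. 0)"
      by (rule has_derivative_unique[OF height_has_derivative(1)[OF uV]])
    then show ?thesis
      using norm_normal_diff_le[OF w d near(2)[OF uc]] by (simp add: fun_eq_iff)
  qed
  moreover have "u0 \<in> ball u0 (R / 2)" "ball u0 (R / 2) \<subseteq> V" using R by auto
  ultimately show ?thesis
    using const open_ball by (intro exI[of _ "ball u0 (R / 2)"]) blast
qed

end

section \<open>Charts of an immersed surface\<close>

context smooth_surface
begin

lemma chart_cases:
  assumes "p \<in> topspace X"
  obtains V \<psi> u where "(V, \<psi>) \<in> A" "u \<in> V" "p = \<psi> u"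
  using assms covering by auto

lemma chart_in_topspace: "(V, \<psi>) \<in> A \<Longrightarrow> u \<in> V \<Longrightarrow> \<psi> u \<in> topspace X"
  using covering by auto

lemma chart_homeomorphic:
  assumes "(V, \<psi>) \<in> A"
  shows "homeomorphic_map (top_of_set V) (subtopology X (\<psi> ` V)) \<psi>"
  using parametrization[OF assms] by (simp add: embedding_map_def)

lemma chart_inj_on: "(V, \<psi>) \<in> A \<Longrightarrow> inj_on \<psi> V"
  using homeomorphic_imp_injective_map[OF chart_homeomorphic] by simp

lemma open_chart_domain: "(V, \<psi>) \<in> A \<Longrightarrow> open V"
  using parametrization by blast

lemma openin_chart_image:
  assumes "(V, \<psi>) \<in> A" "open U" "U \<subseteq> V"
  shows "openin X (\<psi> ` U)"
proof -
  have "openin (top_of_set V) U" using assms open_chart_domain openin_open_eq by blast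
  then have "openin (subtopology X (\<psi> ` V)) (\<psi> ` U)"
    using homeomorphic_imp_open_map[OF chart_homeomorphic[OF assms(1)]] by (simp add: open_map_def)
  then show ?thesis using openin_trans_full parametrization[OF assms(1)] by blast
qed

lemma open_chart_preimage:
  assumes "(V, \<psi>) \<in> A" "openin X T"
  shows "open (V \<inter> \<psi> -` T)"
proof -
  have "continuous_map (top_of_set V) X \<psi>"
    using homeomorphic_imp_continuous_map[OF chart_homeomorphic[OF assms(1)]]
    by (simp add: continuous_map_in_subtopology)
  then have "openin (top_of_set V) {x \<in> topspace (top_of_set V). \<psi> x \<in> T}"
    using assms(2) openin_continuous_map_preimage by blast
  moreover have "{x \<in> topspace (top_of_set V). \<psi> x \<in> T} = V \<inter> \<psi> -` T" by auto
  ultimately show ?thesis using openin_open_trans open_chart_domain[OF assms(1)] by metis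
qed

lemma continuous_map_charts:
  fixes g :: "'a \<Rightarrow> 'b::topological_space"
  assumes "\<And>V \<psi>. (V, \<psi>) \<in> A \<Longrightarrow> continuous_on V (g \<circ> \<psi>)"
  shows "continuous_map X euclidean g"
  unfolding continuous_map_def
proof (intro conjI allI impI)
  fix T :: "'b set" assume "openin euclidean T"
  then have T: "open T" by simp
  have "openin X (\<psi> ` (V \<inter> (g \<circ> \<psi>) -` T))" if "(V, \<psi>) \<in> A" for V \<psi>
    using continuous_open_preimage[OF assms[OF that] open_chart_domain[OF that] T]
    by (intro openin_chart_image[OF that]) auto
  then have "openin X (\<Union>(V, \<psi>)\<in>A. \<psi> ` (V \<inter> (g \<circ> \<psi>) -` T))" by auto
  moreover have "(\<Union>(V, \<psi>)\<in>A. \<psi> ` (V \<inter> (g \<circ> \<psi>) -` T)) = {x \<in> topspace X. g x \<in> T}"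
    unfolding covering by fastforce
  ultimately show "openin X {x \<in> topspace X. g x \<in> T}" by simp
qed simp

text \<open>One linear map \<open>D\<close>, the derivative of the transition map, serves for every \<open>g\<close>, so a principal frame in
  one chart is carried to a principal frame in the other by applying \<open>D\<close> to \<open>f\<close> and \<open>N\<close> alike.\<close>

lemma transition_derivative:
  assumes c: "(V, \<psi>) \<in> A" "(V', \<psi>') \<in> A" and u: "u \<in> V" "u' \<in> V'" "\<psi> u = \<psi>' u'"
  obtains D where "\<And>g :: 'a \<Rightarrow> 'b::real_normed_vector. smooth_on (g \<circ> \<psi>) V \<Longrightarrow>
     frechet_derivative (g \<circ> \<psi>') (at u') = frechet_derivative (g \<circ> \<psi>) (at u) \<circ> D"
proof -
  define \<tau> where "\<tau> = inv_into V \<psi> \<circ> \<psi>'"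
  define W where "W = V' \<inter> \<psi>' -` (\<psi> ` V)"
  have W: "open W" "u' \<in> W"
    using open_chart_preimage[OF c(2) openin_chart_image[OF c(1) open_chart_domain[OF c(1)] order_refl]] u
    by (auto simp: W_def) (metis imageI)
  have "smooth_on \<tau> W" unfolding \<tau>_def W_def by (rule transition[OF c(2,1)])
  then have D\<tau>: "(\<tau> has_derivative frechet_derivative \<tau> (at u')) (at u')"
    using W(2) by (rule smooth_on_has_derivative)
  have \<tau>u: "\<tau> u' = u" using chart_inj_on[OF c(1)] u by (simp add: \<tau>_def flip: u(3))
  show ?thesis
  proof
    fix g :: "'a \<Rightarrow> 'b" assume "smooth_on (g \<circ> \<psi>) V"
    then have Dg: "(g \<circ> \<psi> has_derivative frechet_derivative (g \<circ> \<psi>) (at u)) (at (\<tau> u'))"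
      unfolding \<tau>u using u(1) by (rule smooth_on_has_derivative)
    have "((g \<circ> \<psi>) \<circ> \<tau> has_derivative frechet_derivative (g \<circ> \<psi>) (at u) \<circ> frechet_derivative \<tau> (at u')) (at u')"
      by (rule diff_chain_at[OF D\<tau> Dg])
    then have "(g \<circ> \<psi>' has_derivative frechet_derivative (g \<circ> \<psi>) (at u) \<circ> frechet_derivative \<tau> (at u')) (at u')"
    proof (rule has_derivative_transform_within_open[OF _ W])
      fix x assume "x \<in> W"
      then show "(g \<circ> \<psi> \<circ> \<tau>) x = (g \<circ> \<psi>') x"
        by (simp add: W_def \<tau>_def f_inv_into_f)
    qed
    then show "frechet_derivative (g \<circ> \<psi>') (at u')
        = frechet_derivative (g \<circ> \<psi>) (at u) \<circ> frechet_derivative \<tau> (at u')"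
      by (rule frechet_derivative_at[symmetric])
  qed
qed

end

context oriented_immersed_surface
begin

lemma parametrized_surface_chart:
  assumes "(V, \<psi>) \<in> A"
  shows "parametrized_surface V (f \<circ> \<psi>) (N \<circ> \<psi>)"
proof
  show "norm ((N \<circ> \<psi>) u) = 1" if "u \<in> V" for u
    using unit_N[OF chart_in_topspace[OF assms that]] by simp
qed (use assms open_chart_domain smooth_f smooth_N immersion normal_N in auto)

lemma continuous_map_f: "continuous_map X euclidean f"
  by (rule continuous_map_charts) (rule smooth_on_continuous[OF smooth_f])

lemma continuous_map_N: "continuous_map X euclidean N"
  by (rule continuous_map_charts) (rule smooth_on_continuous[OF smooth_N])

text \<open>The description in the definition of \<open>mean_curvature\<close> ranges over all charts and frames at the
  point. A change of charts preserves principal frames, and within one chart the trace is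
  independent of the frame, so the described value is unique.\<close>

lemma mean_curvature_principal_frame:
  assumes c: "(V, \<psi>) \<in> A" "u \<in> V"
    and frame: "principal_frame (frechet_derivative (f \<circ> \<psi>) (at u)) (frechet_derivative (N \<circ> \<psi>) (at u)) w1 w2 k1 k2"
  shows "mean_curvature A f N (\<psi> u) = (k1 + k2) / 2"
  unfolding mean_curvature_def
proof (rule the_equality)
  have "principal_curvatures A f N (\<psi> u) k1 k2"
    using c frame unfolding principal_curvatures_def principal_frame_def Let_def by blast
  then show "\<exists>l1 l2. principal_curvatures A f N (\<psi> u) l1 l2 \<and> (k1 + k2) / 2 = (l1 + l2) / 2" by blast
next
  fix h assume "\<exists>l1 l2. principal_curvatures A f N (\<psi> u) l1 l2 \<and> h = (l1 + l2) / 2"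
  then obtain l1 l2 V' \<psi>' u' v1 v2 where c': "(V', \<psi>') \<in> A" "u' \<in> V'" "\<psi>' u' = \<psi> u"
    and frame': "principal_frame (frechet_derivative (f \<circ> \<psi>') (at u')) (frechet_derivative (N \<circ> \<psi>') (at u')) v1 v2 l1 l2"
    and h: "h = (l1 + l2) / 2"
    unfolding principal_curvatures_def principal_frame_def Let_def by auto
  obtain D where D: "\<And>g :: 'a \<Rightarrow> real^3. smooth_on (g \<circ> \<psi>) V \<Longrightarrow>
     frechet_derivative (g \<circ> \<psi>') (at u') = frechet_derivative (g \<circ> \<psi>) (at u) \<circ> D"
    using transition_derivative[OF c(1) c'(1) c(2) c'(2) c'(3)[symmetric]] by blast
  have "principal_frame (frechet_derivative (f \<circ> \<psi>) (at u)) (frechet_derivative (N \<circ> \<psi>) (at u)) (D v1) (D v2) l1 l2"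
    using frame' unfolding D[OF smooth_f[OF c(1)]] D[OF smooth_N[OF c(1)]]
    by (simp add: principal_frame_def)
  moreover have "tangent_data (frechet_derivative (f \<circ> \<psi>) (at u)) (frechet_derivative (N \<circ> \<psi>) (at u)) ((N \<circ> \<psi>) u)"
    by (rule parametrized_surface.tangent_data_at[OF parametrized_surface_chart[OF c(1)] c(2)])
  ultimately have "k1 + k2 = l1 + l2"
    using frame tangent_data.principal_frame_sum_unique by blast
  then show "h = (k1 + k2) / 2" by (simp add: h)
qed

lemma highest_point:
  assumes "compact_space X"
  obtains p where "p \<in> topspace X" "\<And>q. q \<in> topspace X \<Longrightarrow> d \<bullet> f q \<le> d \<bullet> f p"
proof -
  have "continuous_map X euclidean (\<lambda>q. d \<bullet> f q)"
    using continuous_map_charts[of "\<lambda>q. d \<bullet> f q"] smooth_on_continuous[OF smooth_f]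
    by (fastforce simp: o_def intro: continuous_intros)
  then have "compactin euclidean ((\<lambda>q. d \<bullet> f q) ` topspace X)"
    using assms image_compactin compact_space_def by blast
  then have "compact ((\<lambda>q. d \<bullet> f q) ` topspace X)" by simp
  from compact_attains_sup[OF this] nonempty show ?thesis by (auto intro: that)
qed

lemma highest_point_normal:
  assumes p: "p \<in> topspace X" and max: "\<And>q. q \<in> topspace X \<Longrightarrow> d \<bullet> f q \<le> d \<bullet> f p"
    and d: "norm d = 1"
  shows "(N p = d \<and> mean_curvature A f N p \<le> 0) \<or> (N p = - d \<and> 0 \<le> mean_curvature A f N p)"
proof -
  obtain V \<psi> u where c: "(V, \<psi>) \<in> A" "u \<in> V" "p = \<psi> u" using p by (rule chart_cases)
  interpret P: parametrized_surface V "f \<circ> \<psi>" "N \<circ> \<psi>" by (rule parametrized_surface_chart[OF c(1)])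
  obtain w1 w2 k1 k2 where frame: "principal_frame (P.DF u) (P.DG u) w1 w2 k1 k2"
    using tangent_data.ex_principal_frame[OF P.tangent_data_at[OF c(2)]] by blast
  have "d \<bullet> (f \<circ> \<psi>) x \<le> d \<bullet> (f \<circ> \<psi>) u" if "x \<in> V" for x
    using max[OF chart_in_topspace[OF c(1) that]] c(3) by simp
  from P.maximal_height[OF c(2) d this frame]
  show ?thesis using mean_curvature_principal_frame[OF c(1,2) frame] c(3) by auto
qed

end

section \<open>Closed surfaces of prescribed mean curvature\<close>

text \<open>Differentiability at a zero gives a linear bound around it. It turns the mean curvature of a surface that
  touches its tangent plane into a term controlled by the tilt of the normal.\<close>

lemma C1_on_sphere_zero_bound:
  assumes "C1_on_sphere h" "norm n0 = 1" "h n0 = 0"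
  obtains \<delta> L where "0 < \<delta>" "0 \<le> L"
    "\<And>y. norm y = 1 \<Longrightarrow> norm (y - n0) < \<delta> \<Longrightarrow> \<bar>h y\<bar> \<le> L * norm (y - n0)"
proof -
  have "n0 \<in> sphere 0 1" using assms(2) by simp
  with assms(1) obtain W g where W: "open W" "n0 \<in> W" "C_k_on 1 g W"
    and gh: "\<And>y. y \<in> W \<inter> sphere 0 1 \<Longrightarrow> g y = h y"
    unfolding C1_on_sphere_def by metis
  have "g differentiable (at n0)" using W by simp
  then obtain D where D: "(g has_derivative D) (at n0)" by (auto simp: differentiable_def)
  then have "bounded_linear D" by (rule has_derivative_bounded_linear)
  then obtain B where B: "0 \<le> B" "\<And>x. norm (D x) \<le> norm x * B"
    using bounded_linear.nonneg_bounded by blast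
  obtain d1 where d1: "0 < d1" "\<And>y. norm (y - n0) < d1 \<Longrightarrow> norm (g y - g n0 - D (y - n0)) \<le> 1 * norm (y - n0)"
    using D unfolding has_derivative_at_alt by (metis zero_less_one)
  obtain d2 where d2: "0 < d2" "ball n0 d2 \<subseteq> W" using W open_contains_ball by blast
  show ?thesis
  proof (rule that[of "min d1 d2" "B + 1"])
    fix y :: "real^3" assume y: "norm y = 1" "norm (y - n0) < min d1 d2"
    then have "y \<in> W" using d2 by (auto simp: subset_eq dist_norm norm_minus_commute)
    then have "g y = h y" "g n0 = 0" using gh y W assms by auto
    then have "\<bar>h y - D (y - n0)\<bar> \<le> norm (y - n0)" using d1(2)[of y] y by simp
    then show "\<bar>h y\<bar> \<le> (B + 1) * norm (y - n0)"
      using B(2)[of "y - n0"] by (simp add: algebra_simps)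
  qed (use d1 d2 B in auto)
qed

context prescribed_mean_curvature_surface
begin

text \<open>If \<open>\<H>\<close> vanished at this normal, the set \<open>T\<close> of points at maximal height with the normal \<open>N p\<close> would be
  open by \<open>maximal_height_rigidity\<close>, and it is closed, hence everything. A surface with constant
  normal has no highest point in a horizontal direction.\<close>

lemma highest_point_not_zero:
  assumes compact: "compact_space X" and C1: "C1_on_sphere \<H>"
    and d: "norm d = 1"
    and p: "p \<in> topspace X" and max: "\<And>q. q \<in> topspace X \<Longrightarrow> d \<bullet> f q \<le> d \<bullet> f p"
  shows "\<H> (N p) \<noteq> 0"
proof
  assume zero: "\<H> (N p) = 0"
  define n0 where "n0 = N p"
  have n0: "n0 = d \<or> n0 = - d" using highest_point_normal[OF p max d] by (auto simp: n0_def)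
  then have "norm n0 = 1" using d by auto
  then obtain \<delta> L where lip: "0 < \<delta>" "0 \<le> L"
    "\<And>y. norm y = 1 \<Longrightarrow> norm (y - n0) < \<delta> \<Longrightarrow> \<bar>\<H> y\<bar> \<le> L * norm (y - n0)"
    using C1_on_sphere_zero_bound[OF C1] zero unfolding n0_def by metis
  define T where "T = {q \<in> topspace X. f q \<in> {x. d \<bullet> x = d \<bullet> f p}} \<inter> {q \<in> topspace X. N q \<in> {n0}}"
  have "closedin X T"
    unfolding T_def
    by (intro closedin_Int closedin_continuous_map_preimage[OF continuous_map_f]
        closedin_continuous_map_preimage[OF continuous_map_N])
       (auto simp: closed_hyperplane)
  moreover have "openin X T"
  proof (subst openin_subopen, rule ballI)
    fix q assume q: "q \<in> T"
    then have "q \<in> topspace X" by (simp add: T_def)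
    then obtain V \<psi> u where c: "(V, \<psi>) \<in> A" "u \<in> V" "q = \<psi> u" by (rule chart_cases)
    interpret P: parametrized_surface V "f \<circ> \<psi>" "N \<circ> \<psi>" by (rule parametrized_surface_chart[OF c(1)])
    have top: "\<psi> x \<in> topspace X" if "x \<in> V" for x by (rule chart_in_topspace[OF c(1) that])
    have mean: "(k1 + k2) / 2 = \<H> ((N \<circ> \<psi>) x)"
      if "x \<in> V" "principal_frame (P.DF x) (P.DG x) w1 w2 k1 k2" for x w1 w2 k1 k2
      using mean_curvature_principal_frame[OF c(1) that] mean_curvature_eq[OF top[OF that(1)]] by simp
    have below: "d \<bullet> (f \<circ> \<psi>) x \<le> d \<bullet> (f \<circ> \<psi>) u" if "x \<in> V" for x
      using max[OF top[OF that]] q c(3) by (simp add: T_def)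
    have Nu: "(N \<circ> \<psi>) u = n0" using q c(3) by (simp add: T_def)
    have "\<exists>U. open U \<and> u \<in> U \<and> U \<subseteq> V \<and>
        (\<forall>x\<in>U. d \<bullet> (f \<circ> \<psi>) x = d \<bullet> (f \<circ> \<psi>) u \<and> (N \<circ> \<psi>) x = n0)"
      by (rule P.maximal_height_rigidity[OF c(2) d n0 Nu mean lip below])
    then obtain U where U: "open U" "u \<in> U" "U \<subseteq> V"
      "\<And>x. x \<in> U \<Longrightarrow> d \<bullet> (f \<circ> \<psi>) x = d \<bullet> (f \<circ> \<psi>) u \<and> (N \<circ> \<psi>) x = n0"
      by blast
    have "\<psi> ` U \<subseteq> T" using U(3,4) top q c(3) by (auto simp: T_def)
    moreover have "openin X (\<psi> ` U)" by (rule openin_chart_image[OF c(1) U(1,3)])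
    ultimately show "\<exists>S. openin X S \<and> q \<in> S \<and> S \<subseteq> T" using U(2) c(3) by blast
  qed
  moreover have "p \<in> T" using p by (simp add: T_def n0_def)
  ultimately have T: "T = topspace X" using connected unfolding connected_space_clopen_in by blast
  obtain y :: "real^3" where y: "y \<noteq> 0" "orthogonal d y"
    using orthogonal_to_vector_exists[of d] by auto
  define e where "e = y /\<^sub>R norm y"
  have e: "norm e = 1" "d \<bullet> e = 0" using y by (simp_all add: e_def orthogonal_def)
  obtain q where q: "q \<in> topspace X" "\<And>r. r \<in> topspace X \<Longrightarrow> e \<bullet> f r \<le> e \<bullet> f q"
    using highest_point[OF compact] by blast
  have "N q = e \<or> N q = - e" using highest_point_normal[OF q e(1)] by blast
  moreover have "N q = n0" using q(1) T by (auto simp: T_def)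
  ultimately have "d = e \<or> d = - e" using n0 by auto
  then show False using e by (auto simp: norm_eq_1)
qed

text \<open>An immersed surface may have the same normal at its highest and at its lowest point. That is
  why both points are compared: if neither has normal \<open>n\<close>, the two signs of the mean curvature make
  \<open>- n\<close> a zero of \<open>\<H>\<close>.\<close>

lemma not_compact_if_zero:
  assumes C1: "C1_on_sphere \<H>" and n: "norm n = 1" "\<H> n = 0"
  shows "\<not> compact_space X"
proof
  assume compact: "compact_space X"
  note nonzero = highest_point_not_zero[OF compact C1]
  obtain p where p: "p \<in> topspace X" "\<And>q. q \<in> topspace X \<Longrightarrow> n \<bullet> f q \<le> n \<bullet> f p"
    using highest_point[OF compact] by blast
  obtain q where q: "q \<in> topspace X" "\<And>r. r \<in> topspace X \<Longrightarrow> - n \<bullet> f r \<le> - n \<bullet> f q"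
    using highest_point[OF compact] by blast
  have n': "norm (- n) = 1" using n by simp
  have "\<H> (N p) \<noteq> 0" by (rule nonzero[OF n(1) p])
  then have "N p = - n" "0 \<le> \<H> (- n)"
    using highest_point_normal[OF p n(1)] mean_curvature_eq[OF p(1)] n by auto
  have "\<H> (N q) \<noteq> 0" by (rule nonzero[OF n' q])
  then have "N q = - n" "\<H> (- n) \<le> 0"
    using highest_point_normal[OF q n'] mean_curvature_eq[OF q(1)] n by auto
  with \<open>0 \<le> \<H> (- n)\<close> \<open>\<H> (N q) \<noteq> 0\<close> show False by simp
qed

end

theorem proposition2p4:
  fixes \<H> :: "real^3 \<Rightarrow> real"
  assumes "C1_on_sphere \<H>"
    and "\<exists>x\<in>sphere 0 1. \<H> x = 0"
  shows "\<not> (\<exists>(X :: 'a topology) (A :: 'a atlas) f N.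
           prescribed_mean_curvature_surface X A f N \<H> \<and> closed_surface X A)"
proof -
  from assms(2) obtain n where "norm n = 1" "\<H> n = 0" by auto
  with assms(1) show ?thesis
    unfolding closed_surface_def by (blast dest: prescribed_mean_curvature_surface.not_compact_if_zero)
qed

end
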